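(* Let $\rho\neq0$ be real, and let $\phi_{[1]},\phi_{[3]}$ be the solutions of $$\phi^{(4)}+\rho x^3\phi=0$$ with $\phi_{[1]}(0)=0$, $\phi_{[1]}'(0)=1$, $\phi_{[1]}''(0)=\phi_{[1]}'''(0)=0$, and $\phi_{[3]}(0)=\phi_{[3]}'(0)=\phi_{[3]}''(0)=0$, $\phi_{[3]}'''(0)=1$. Let $v_{[r]}(t,x)=P_t\phi_{[r]}(x)$, $r=1,3$, be their heat transforms, which are analytic near $(t,x)=(0,0)$. Then for each $r\in\{1,3\}$ there is a unique germ $F_{[r]}$, analytic in the graded variable $t^7$ (that is, $F_{[r]}(t)=t^4y_r(t^7)$ with $y_r$ analytic at $0$), such that $$v_{[r]}(t,F_{[r]}(t))=0,\qquad F_{[r]}(t)=\frac{\rho}{16}t^4+O(t^{11}).$$ These germs coincide with the two determinant branches $F_1,F_2$: $$F_{[1]}=F_1,\qquad F_{[3]}=F_2,$$ so the first analytic boundary branch is generated by the residue-$1$ stationary solution $\phi_{[1]}$ and the second by the residue-$3$ stationary solution $\phi_{[3]}$.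
   Context: The heat action $P_t=\exp(\frac t2\partial_x^2)$ is defined on monomials by $$P_tx^n=\sum_{k=0}^{\lfloor n/2\rfloor}\frac{n!}{(n-2k)!\,k!}\left(\frac t2\right)^kx^{n-2k},$$ and is extended termwise to the power series of $\phi_{[r]}$ (the resulting series converges near $(0,0)$). "Residue-$r$" refers to the fact that the power series of $\phi_{[r]}$ is supported on powers $x^k$ with $k\equiv r\pmod 7$. The determinant branches are $$F_j(t)=\rho\left(\frac t2\right)^4\Phi_j\!\left(\rho^2\left(\frac t2\right)^7\right),\qquad j=1,2,$$ where $\Phi_1,\Phi_2$ are the two germs analytic at $z=0$ that satisfy $\mathcal E[\Phi]=0$ and $\Phi(0)=1$; they are characterized by $\Phi_1'(0)=\frac15$ and $\Phi_2'(0)=\frac16$ respectively (each of these values determines the analytic solution uniquely). Here, with $\theta=z\,\frac{d}{dz}$, $A=(4+7\theta)\Phi$, $B=(3+7\theta)A$, $C=(2+7\theta)B$, \begin{align*} \mathcal E[\Phi]={}&240+8C-72B+3B^2+48A-2AC\\ &+z\bigl[-512B+192AB+384A^2-48A^2B-48A^3+4A^3B\\ &\qquad+192\Phi B-768\Phi A+48\Phi A^2+240\Phi^2-24\Phi^2B+12\Phi^2A\bigr]\\ &+z^2\bigl[512A^3-192A^4+24A^5-A^6-1536\Phi A^2+384\Phi A^3-24\Phi A^4\\ &\qquad+1536\Phi^2A-192\Phi^2A^2-512\Phi^3-32\Phi^3A+4\Phi^3A^2+36\Phi^4\bigr]. \end{align*} *)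

theory Defs
  imports "HOL-Analysis.Analysis" "HOL-Library.Landau_Symbols"
begin

text \<open>
  A germ at 0 is represented by a function on the reals; two functions represent the same
  germ iff they agree eventually in \<^term>\<open>nhds (0::real)\<close>. Analytic means real-analytic.
\<close>

definition germ_eq :: "(real \<Rightarrow> real) \<Rightarrow> (real \<Rightarrow> real) \<Rightarrow> bool" where
  "germ_eq f g \<longleftrightarrow> (\<forall>\<^sub>F t in nhds 0. f t = g t)"

definition unique_germ :: "((real \<Rightarrow> real) \<Rightarrow> bool) \<Rightarrow> (real \<Rightarrow> real) \<Rightarrow> bool" where
  "unique_germ P f \<longleftrightarrow> P f \<and> (\<forall>g. P g \<longrightarrow> germ_eq g f)"

definition analytic_germ :: "(real \<Rightarrow> real) \<Rightarrow> bool" where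
  "analytic_germ f \<longleftrightarrow> (\<exists>P. f has_fps_expansion P)"

definition analytic_near_origin :: "(real \<Rightarrow> real \<Rightarrow> real) \<Rightarrow> bool" where
  "analytic_near_origin v \<longleftrightarrow>
     (\<exists>(c :: nat \<Rightarrow> nat \<Rightarrow> real) e. e > 0 \<and>
        (\<forall>t x. \<bar>t\<bar> < e \<longrightarrow> \<bar>x\<bar> < e \<longrightarrow>
           ((\<lambda>(i, j). c i j * t ^ i * x ^ j) has_sum v t x) UNIV))"


text \<open>Differentiability is explicit because \<^const>\<open>deriv\<close> is a total operator.\<close>

definition stationary_solution :: "real \<Rightarrow> (real \<Rightarrow> real) \<Rightarrow> bool" where
  "stationary_solution \<rho> \<phi> \<longleftrightarrow>
     (\<forall>k<4. \<forall>x. (deriv ^^ k) \<phi> field_differentiable (at x)) \<and>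
     (\<forall>x. (deriv ^^ 4) \<phi> x + \<rho> * x ^ 3 * \<phi> x = 0)"


definition heat_monomial :: "real \<Rightarrow> nat \<Rightarrow> real \<Rightarrow> real" where
  "heat_monomial t n x =
     (\<Sum>k = 0..n div 2. fact n / (fact (n - 2 * k) * fact k) * (t / 2) ^ k * x ^ (n - 2 * k))"

definition heat_term :: "(real \<Rightarrow> real) \<Rightarrow> real \<Rightarrow> real \<Rightarrow> nat \<Rightarrow> real" where
  "heat_term \<phi> t x n = (deriv ^^ n) \<phi> 0 / fact n * heat_monomial t n x"

definition heat_transform :: "(real \<Rightarrow> real) \<Rightarrow> real \<Rightarrow> real \<Rightarrow> real" where
  "heat_transform \<phi> t x = (\<Sum>n. heat_term \<phi> t x n)"


definition boundary_germ :: "real \<Rightarrow> (real \<Rightarrow> real \<Rightarrow> real) \<Rightarrow> (real \<Rightarrow> real) \<Rightarrow> bool" where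
  "boundary_germ \<rho> v F \<longleftrightarrow>
     (\<exists>y. analytic_germ y \<and> germ_eq F (\<lambda>t. t ^ 4 * y (t ^ 7))) \<and>
     (\<forall>\<^sub>F t in nhds 0. v t (F t) = 0) \<and>
     (\<lambda>t. F t - \<rho> / 16 * t ^ 4) \<in> O[nhds 0](\<lambda>t. t ^ 11)"


definition theta :: "(real \<Rightarrow> real) \<Rightarrow> real \<Rightarrow> real" where
  "theta f = (\<lambda>z. z * deriv f z)"

definition opA :: "(real \<Rightarrow> real) \<Rightarrow> real \<Rightarrow> real" where
  "opA \<Phi> = (\<lambda>z. 4 * \<Phi> z + 7 * theta \<Phi> z)"

definition opB :: "(real \<Rightarrow> real) \<Rightarrow> real \<Rightarrow> real" where
  "opB \<Phi> = (\<lambda>z. 3 * opA \<Phi> z + 7 * theta (opA \<Phi>) z)"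

definition opC :: "(real \<Rightarrow> real) \<Rightarrow> real \<Rightarrow> real" where
  "opC \<Phi> = (\<lambda>z. 2 * opB \<Phi> z + 7 * theta (opB \<Phi>) z)"

definition det_expr :: "(real \<Rightarrow> real) \<Rightarrow> real \<Rightarrow> real" where
  "det_expr \<Phi> z =
    (let P = \<Phi> z; A = opA \<Phi> z; B = opB \<Phi> z; C = opC \<Phi> z in
       240 + 8*C - 72*B + 3*B^2 + 48*A - 2*A*C
       + z * (- 512*B + 192*A*B + 384*A^2 - 48*A^2*B - 48*A^3 + 4*A^3*B
              + 192*P*B - 768*P*A + 48*P*A^2 + 240*P^2 - 24*P^2*B + 12*P^2*A)
       + z^2 * (512*A^3 - 192*A^4 + 24*A^5 - A^6 - 1536*P*A^2 + 384*P*A^3 - 24*P*A^4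
                + 1536*P^2*A - 192*P^2*A^2 - 512*P^3 - 32*P^3*A + 4*P^3*A^2 + 36*P^4))"

definition det_solution :: "(real \<Rightarrow> real) \<Rightarrow> bool" where
  "det_solution \<Phi> \<longleftrightarrow>
     analytic_germ \<Phi> \<and> (\<forall>\<^sub>F z in nhds 0. det_expr \<Phi> z = 0) \<and> \<Phi> 0 = 1"

definition det_branch :: "real \<Rightarrow> (real \<Rightarrow> real) \<Rightarrow> real \<Rightarrow> real" where
  "det_branch \<rho> \<Phi> t = \<rho> * (t / 2) ^ 4 * \<Phi> (\<rho>\<^sup>2 * (t / 2) ^ 7)"

end

theory Submission
  imports Defs "HOL-Complex_Analysis.Laurent_Convergence"
begin

text \<open>
  Let \<open>v = P_t \<phi>\<close> be the heat transform of a stationary solution, and let \<open>x = F(t)\<close> be one of the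
  determinant branches. The heat equation \<open>v_t = v_xx / 2\<close> gives
  \<open>d/dt v(t, F) = v_xx / 2 + F' v_x\<close>, and the relation \<open>P_t (x f) = (x + t \<partial>_x) P_t f\<close> turns the
  equation of \<open>\<phi>\<close> into \<open>v_xxxx = - \<rho> (x + t \<partial>_x)^3 v\<close>. Hence the values \<open>W, W_1, W_2, W_3\<close> of
  \<open>v, v_x, v_xx, v_xxx\<close> along the curve form a closed linear differential system, and \<open>W', W'', W'''\<close>
  are linear combinations of them. Eliminating \<open>W_2\<close> and \<open>W_3\<close> leaves a third order linear equation
  for \<open>W\<close> whose right-hand side is a multiple of \<open>\<E>[\<Phi>] W_1\<close>, because \<open>\<E>\<close> is the
  determinant of the system (\<open>boundary_elimination\<close>).

  If \<open>\<E>[\<Phi>] = 0\<close>, then \<open>W\<close> solves a homogeneous linear equation with a regular singular point at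
  \<open>t = 0\<close>. Its exponents are 0, 1 and \<open>17 - 1 / \<Phi>'(0)\<close>, that is 0, 1, 12 for \<open>\<Phi>1\<close> and 0, 1, 11 for
  \<open>\<Phi>2\<close>. On the other hand, for a solution of residue \<open>r\<close> the series \<open>W\<close> contains only powers \<open>t^n\<close>
  with \<open>n\<close> congruent to \<open>4 r\<close> modulo 7: to 4 for \<open>r = 1\<close>, to 5 for \<open>r = 3\<close>. No exponent
  qualifies, so \<open>W = 0\<close> (\<open>fps_branch_heat_zero\<close>), and the branch is a zero curve of \<open>v\<close>. The
  third exponent belongs to the stationary solution of the other residue, which explains why \<open>\<phi>1\<close>
  pairs with \<open>\<Phi>1\<close> and \<open>\<phi>3\<close> with \<open>\<Phi>2\<close>.

  Uniqueness (\<open>heat_subst_inj\<close>) compares two zero curves of order \<open>t^4\<close>: the lowest term of their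
  difference is multiplied by \<open>v_x(t, 0)\<close>, which starts with \<open>1\<close> or with \<open>t / 2\<close>.

  The algebra takes place in formal power series in \<open>t\<close>. It says something about the functions
  because the Taylor coefficients of \<open>\<phi>\<close> obey a seven-step recurrence. It bounds \<open>\<phi>^(n)(0)\<close> by
  \<open>K^n n! / (n div 2)!\<close>, so the double series of \<open>v\<close> converges absolutely near the origin
  (\<open>heat_coeff_growth\<close>), and so does its substitution along an analytic curve
  (\<open>heat_subst_has_fps_expansion\<close>).
\<close>

unbundle no vec_syntax
no_notation Infinite_Set_Sum.abs_summable_on (infix \<open>abs'_summable'_on\<close> 50)

section \<open>Formal substitution of a curve into the heat series\<close>

text \<open>
  A smooth function \<open>f\<close> enters only through its Taylor data \<open>\<alpha> n = f^(n)(0)\<close>. On such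
  sequences differentiation of \<open>f\<close> is \<open>seq_shift\<close>, and multiplication of \<open>f\<close> by \<open>x\<close> is
  \<open>seq_mult_x\<close>; the truncated \<open>n - 1\<close> at \<open>n = 0\<close> is harmless because of the factor \<open>n\<close>.
\<close>

definition seq_shift :: "(nat \<Rightarrow> real) \<Rightarrow> nat \<Rightarrow> real" where
  "seq_shift \<alpha> n = \<alpha> (Suc n)"

definition seq_mult_x :: "(nat \<Rightarrow> real) \<Rightarrow> nat \<Rightarrow> real" where
  "seq_mult_x \<alpha> n = real n * \<alpha> (n - 1)"

text \<open>
  The coefficient of \<open>t^k x^j\<close> in \<open>P_t f(x)\<close>: a monomial \<open>\<alpha> n x^n / n!\<close> contributes to it
  exactly when \<open>n = j + 2 k\<close>.
\<close>

definition heat_coeff :: "(nat \<Rightarrow> real) \<Rightarrow> nat \<Rightarrow> nat \<Rightarrow> real" where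
  "heat_coeff \<alpha> k j = \<alpha> (j + 2 * k) / (fact j * fact k * 2 ^ k)"

definition heat_partial :: "nat \<Rightarrow> nat \<Rightarrow> real fps \<Rightarrow> (nat \<Rightarrow> real) \<Rightarrow> real fps" where
  "heat_partial K J F \<alpha> =
     (\<Sum>k\<le>K. \<Sum>j\<le>J. fps_const (heat_coeff \<alpha> k j) * (fps_X ^ k * F ^ j))"

text \<open>
  The formal power series of \<open>v(t, F(t))\<close> for the heat transform \<open>v\<close> of \<open>\<alpha>\<close>. If \<open>F(0) = 0\<close>,
  then \<open>t^k F(t)^j\<close> starts in degree at least \<open>k + j\<close>, so the partial sum up to \<open>k, j \<le> n\<close>
  already has the final coefficient of \<open>t^n\<close>.
\<close>

definition heat_subst :: "real fps \<Rightarrow> (nat \<Rightarrow> real) \<Rightarrow> real fps" where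
  "heat_subst F \<alpha> = Abs_fps (\<lambda>n. heat_partial n n F \<alpha> $ n)"

lemma fps_X_power_mult_power_nth_eq_0:
  fixes F :: "'a :: comm_ring_1 fps"
  assumes "F $ 0 = 0" "n < k + j"
  shows "(fps_X ^ k * F ^ j) $ n = 0"
  using assms startsby_zero_power_prefix[of F j]
  by (auto simp: fps_X_power_mult_nth)

lemma heat_partial_nth:
  "heat_partial K J F \<alpha> $ n =
     (\<Sum>k\<le>K. \<Sum>j\<le>J. heat_coeff \<alpha> k j * (fps_X ^ k * F ^ j) $ n)"
  by (simp add: heat_partial_def fps_sum_nth)

text \<open>
  Every rectangular truncation that is large enough computes the same coefficient. This freedom
  pays for the index shifts caused by differentiating or multiplying a truncation.
\<close>

lemma heat_subst_nth:
  assumes "F $ 0 = 0" "n \<le> K" "n \<le> J"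
  shows "heat_subst F \<alpha> $ n = heat_partial K J F \<alpha> $ n"
proof -
  have zero: "heat_coeff \<alpha> k j * (fps_X ^ k * F ^ j) $ n = 0" if "n < k + j" for k j
    using fps_X_power_mult_power_nth_eq_0[OF assms(1) that] by simp
  have "heat_subst F \<alpha> $ n = (\<Sum>k\<le>n. \<Sum>j\<le>n. heat_coeff \<alpha> k j * (fps_X ^ k * F ^ j) $ n)"
    by (simp add: heat_subst_def heat_partial_nth)
  also have "\<dots> = (\<Sum>k\<le>n. \<Sum>j\<le>J. heat_coeff \<alpha> k j * (fps_X ^ k * F ^ j) $ n)"
    using assms by (intro sum.cong sum.mono_neutral_left ballI refl zero) auto
  also have "\<dots> = (\<Sum>k\<le>K. \<Sum>j\<le>J. heat_coeff \<alpha> k j * (fps_X ^ k * F ^ j) $ n)"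
    using assms by (intro sum.mono_neutral_left ballI sum.neutral zero) auto
  finally show ?thesis by (simp add: heat_partial_nth)
qed

lemma fps_mult_nth_cong:
  fixes A B C :: "'a :: comm_ring_1 fps"
  assumes "\<And>i. i \<le> n \<Longrightarrow> B $ i = C $ i"
  shows "(A * B) $ n = (A * C) $ n"
  unfolding fps_mult_nth using assms by (intro sum.cong) auto

lemma heat_coeff_step_time:
  "real (Suc k) * heat_coeff \<alpha> (Suc k) j = heat_coeff (seq_shift (seq_shift \<alpha>)) k j / 2"
  by (simp add: heat_coeff_def seq_shift_def divide_simps)

lemma heat_coeff_step_space:
  "real (Suc j) * heat_coeff \<alpha> k (Suc j) = heat_coeff (seq_shift \<alpha>) k j"
  by (simp add: heat_coeff_def seq_shift_def divide_simps)

lemma heat_coeff_mult_x: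
  "heat_coeff (seq_mult_x \<alpha>) k j =
     (if j = 0 then 0 else heat_coeff \<alpha> k (j - 1)) +
     (if k = 0 then 0 else heat_coeff (seq_shift \<alpha>) (k - 1) j)"
  by (cases k; cases j)
     (simp_all add: heat_coeff_def seq_shift_def seq_mult_x_def divide_simps,
      simp_all add: algebra_simps)

lemma fps_deriv_monomial:
  fixes F :: "real fps"
  shows "fps_deriv (fps_const c * (fps_X ^ k * F ^ j)) =
     fps_const (real k * c) * (fps_X ^ (k - 1) * F ^ j) +
     fps_const (real j * c) * (fps_X ^ k * (fps_deriv F * F ^ (j - 1)))"
  by (simp add: fps_deriv_power fps_of_nat[symmetric] algebra_simps
        flip: fps_const_mult)

lemma fps_deriv_heat_partial:
  "fps_deriv (heat_partial (Suc K) (Suc J) F \<alpha>) =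
     fps_const (1/2) * heat_partial K (Suc J) F (seq_shift (seq_shift \<alpha>)) +
     fps_deriv F * heat_partial (Suc K) J F (seq_shift \<alpha>)"
proof -
  have "fps_deriv (heat_partial (Suc K) (Suc J) F \<alpha>) =
     (\<Sum>k\<le>Suc K. \<Sum>j\<le>Suc J. fps_const (real k * heat_coeff \<alpha> k j) * (fps_X ^ (k - 1) * F ^ j)) +
     (\<Sum>k\<le>Suc K. \<Sum>j\<le>Suc J. fps_const (real j * heat_coeff \<alpha> k j) *
        (fps_X ^ k * (fps_deriv F * F ^ (j - 1))))"
    by (simp only: heat_partial_def fps_deriv_sum fps_deriv_monomial sum.distrib)
  also have "(\<Sum>k\<le>Suc K. \<Sum>j\<le>Suc J. fps_const (real k * heat_coeff \<alpha> k j) * (fps_X ^ (k - 1) * F ^ j))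
     = fps_const (1/2) * heat_partial K (Suc J) F (seq_shift (seq_shift \<alpha>))"
    by (subst sum.atMost_Suc_shift)
       (simp add: heat_coeff_step_time heat_partial_def sum_distrib_left mult.assoc [symmetric] 
           flip: of_nat_Suc del: sum.atMost_Suc of_nat_Suc)
  also have "(\<Sum>k\<le>Suc K. \<Sum>j\<le>Suc J. fps_const (real j * heat_coeff \<alpha> k j) *
        (fps_X ^ k * (fps_deriv F * F ^ (j - 1))))
     = fps_deriv F * heat_partial (Suc K) J F (seq_shift \<alpha>)"
    by (simp only: sum.atMost_Suc_shift[of _ J])
       (simp add: heat_coeff_step_space heat_partial_def sum_distrib_left mult_ac 
           flip: of_nat_Suc del: sum.atMost_Suc of_nat_Suc)
  finally show ?thesis .
qed

lemma heat_partial_mult_x: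
  "heat_partial (Suc K) (Suc J) F (seq_mult_x \<alpha>) =
     F * heat_partial (Suc K) J F \<alpha> + fps_X * heat_partial K (Suc J) F (seq_shift \<alpha>)"
proof -
  have "heat_partial (Suc K) (Suc J) F (seq_mult_x \<alpha>) =
     (\<Sum>k\<le>Suc K. \<Sum>j\<le>Suc J. fps_const (if j = 0 then 0 else heat_coeff \<alpha> k (j - 1)) * 
         (fps_X ^ k * F ^ j)) +
     (\<Sum>k\<le>Suc K. \<Sum>j\<le>Suc J. fps_const (if k = 0 then 0 else heat_coeff (seq_shift \<alpha>) (k - 1) j) * 
         (fps_X ^ k * F ^ j))"
    by (simp only: heat_partial_def heat_coeff_mult_x fps_const_add[symmetric] distrib_right
          sum.distrib)
  also have "(\<Sum>k\<le>Suc K. \<Sum>j\<le>Suc J. fps_const (if j = 0 then 0 else heat_coeff \<alpha> k (j - 1)) * 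
         (fps_X ^ k * F ^ j)) = F * heat_partial (Suc K) J F \<alpha>"
    by (simp only: sum.atMost_Suc_shift[of _ J])
       (simp add: heat_partial_def sum_distrib_left mult_ac del: sum.atMost_Suc)
  also have "(\<Sum>k\<le>Suc K. \<Sum>j\<le>Suc J. 
         fps_const (if k = 0 then 0 else heat_coeff (seq_shift \<alpha>) (k - 1) j) * 
         (fps_X ^ k * F ^ j)) = fps_X * heat_partial K (Suc J) F (seq_shift \<alpha>)"
    by (simp only: sum.atMost_Suc_shift[of _ K])
       (simp add: heat_partial_def sum_distrib_left mult_ac del: sum.atMost_Suc)
  finally show ?thesis .
qed

text \<open>
  The chain rule \<open>d/dt v(t, F) = v_t + F' v_x\<close> combined with the heat equation \<open>v_t = v_xx / 2\<close>.
\<close>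

lemma fps_deriv_heat_subst:
  assumes "F $ 0 = 0"
  shows "fps_deriv (heat_subst F \<alpha>) =
     fps_const (1/2) * heat_subst F (seq_shift (seq_shift \<alpha>)) +
     fps_deriv F * heat_subst F (seq_shift \<alpha>)"
proof (rule fps_ext)
  fix n
  have "fps_deriv (heat_subst F \<alpha>) $ n = fps_deriv (heat_partial (Suc n) (Suc n) F \<alpha>) $ n"
    using heat_subst_nth[OF assms, of "Suc n" "Suc n" "Suc n" \<alpha>] by simp
  also have "\<dots> = (fps_const (1/2) * heat_partial n (Suc n) F (seq_shift (seq_shift \<alpha>))) $ n +
     (fps_deriv F * heat_partial (Suc n) n F (seq_shift \<alpha>)) $ n"
    by (simp only: fps_deriv_heat_partial fps_add_nth)
  also have "\<dots> = (fps_const (1/2) * heat_subst F (seq_shift (seq_shift \<alpha>))) $ n +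
     (fps_deriv F * heat_subst F (seq_shift \<alpha>)) $ n"
    by (intro arg_cong2[where f = "(+)"] fps_mult_nth_cong heat_subst_nth[OF assms, symmetric]) auto
  finally show "fps_deriv (heat_subst F \<alpha>) $ n =
     (fps_const (1/2) * heat_subst F (seq_shift (seq_shift \<alpha>)) +
      fps_deriv F * heat_subst F (seq_shift \<alpha>)) $ n" by simp
qed

text \<open>
  The intertwining relation \<open>P_t (x f) = (x + t \<partial>_x) P_t f\<close>, read along the curve \<open>x = F(t)\<close>.
\<close>

lemma heat_subst_mult_x:
  assumes "F $ 0 = 0"
  shows "heat_subst F (seq_mult_x \<alpha>) =
     F * heat_subst F \<alpha> + fps_X * heat_subst F (seq_shift \<alpha>)"
proof (rule fps_ext)
  fix n
  have "heat_subst F (seq_mult_x \<alpha>) $ n = heat_partial (Suc n) (Suc n) F (seq_mult_x \<alpha>) $ n"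
    by (rule heat_subst_nth[OF assms]) auto
  also have "\<dots> = (F * heat_partial (Suc n) n F \<alpha>) $ n +
     (fps_X * heat_partial n (Suc n) F (seq_shift \<alpha>)) $ n"
    by (simp only: heat_partial_mult_x fps_add_nth)
  also have "\<dots> = (F * heat_subst F \<alpha>) $ n + (fps_X * heat_subst F (seq_shift \<alpha>)) $ n"
    by (intro arg_cong2[where f = "(+)"] fps_mult_nth_cong heat_subst_nth[OF assms, symmetric]) auto
  finally show "heat_subst F (seq_mult_x \<alpha>) $ n =
     (F * heat_subst F \<alpha> + fps_X * heat_subst F (seq_shift \<alpha>)) $ n" by simp
qed

lemma heat_coeff_add: "heat_coeff (\<lambda>n. \<alpha> n + \<beta> n) k j = heat_coeff \<alpha> k j + heat_coeff \<beta> k j"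
  by (simp add: heat_coeff_def add_divide_distrib)

lemma heat_coeff_cmult: "heat_coeff (\<lambda>n. c * \<alpha> n) k j = c * heat_coeff \<alpha> k j"
  by (simp add: heat_coeff_def)

lemma heat_subst_add:
  "heat_subst F (\<lambda>n. \<alpha> n + \<beta> n) = heat_subst F \<alpha> + heat_subst F \<beta>"
  by (rule fps_ext)
     (simp add: heat_subst_def heat_partial_nth heat_coeff_add distrib_right sum.distrib)

lemma heat_subst_cmult: "heat_subst F (\<lambda>n. c * \<alpha> n) = fps_const c * heat_subst F \<alpha>"
  by (rule fps_ext)
     (simp add: heat_subst_def heat_partial_nth heat_coeff_cmult sum_distrib_left mult.assoc)

text \<open>
  The commutator relation \<open>\<partial>_x x = x \<partial>_x + 1\<close>.
\<close>

lemma seq_shift_mult_x: "seq_shift (seq_mult_x \<alpha>) = (\<lambda>n. seq_mult_x (seq_shift \<alpha>) n + \<alpha> n)"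
  by (rule ext, rename_tac n, case_tac n)
     (simp_all add: seq_shift_def seq_mult_x_def algebra_simps)

lemma seq_shift_add: "seq_shift (\<lambda>n. \<alpha> n + \<beta> n) = (\<lambda>n. seq_shift \<alpha> n + seq_shift \<beta> n)"
  by (simp add: seq_shift_def fun_eq_iff)

lemma heat_subst_mult_x2:
  assumes "F $ 0 = 0"
  shows "heat_subst F (seq_mult_x (seq_mult_x \<alpha>)) =
     (F^2 + fps_X) * heat_subst F \<alpha> + 2 * F * fps_X * heat_subst F (seq_shift \<alpha>)
     + fps_X^2 * heat_subst F (seq_shift (seq_shift \<alpha>))"
  by (simp add: heat_subst_mult_x[OF assms] seq_shift_mult_x seq_shift_add heat_subst_add heat_subst_cmult
        numeral_fps_const[symmetric])
     (simp add: algebra_simps power2_eq_square)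

lemma heat_subst_mult_x3:
  assumes "F $ 0 = 0"
  shows "heat_subst F (seq_mult_x (seq_mult_x (seq_mult_x \<alpha>))) =
     (F^3 + 3 * F * fps_X) * heat_subst F \<alpha>
     + (3 * F^2 * fps_X + 3 * fps_X^2) * heat_subst F (seq_shift \<alpha>)
     + 3 * F * fps_X^2 * heat_subst F (seq_shift (seq_shift \<alpha>))
     + fps_X^3 * heat_subst F (seq_shift (seq_shift (seq_shift \<alpha>)))"
  by (simp add: heat_subst_mult_x[OF assms] seq_shift_mult_x seq_shift_add heat_subst_add heat_subst_cmult
        numeral_fps_const[symmetric])
     (simp add: algebra_simps power2_eq_square power3_eq_cube)

section \<open>Convergence of the heat series along an analytic curve\<close>

definition heat_eval :: "(nat \<Rightarrow> real) \<Rightarrow> real \<Rightarrow> real \<Rightarrow> real" where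
  "heat_eval \<alpha> t x = (\<Sum>\<^sub>\<infinity>(k, j). heat_coeff \<alpha> k j * t ^ k * x ^ j)"

text \<open>
  Majorant: coefficients of products and powers are dominated by those of the majorants.
\<close>

definition fps_abs :: "real fps \<Rightarrow> real fps" where
  "fps_abs F = Abs_fps (\<lambda>n. \<bar>F $ n\<bar>)"

lemma fps_abs_nth [simp]: "fps_abs F $ n = \<bar>F $ n\<bar>"
  by (simp add: fps_abs_def)

lemma fps_conv_radius_abs [simp]: "fps_conv_radius (fps_abs F) = fps_conv_radius F"
  using fps_conv_radius_norm[of F] by (simp add: fps_abs_def)

lemma fps_nth_mult_abs_le:
  fixes F G A B :: "real fps"
  assumes "\<And>n. \<bar>F $ n\<bar> \<le> A $ n" "\<And>n. \<bar>G $ n\<bar> \<le> B $ n"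
  shows "\<bar>(F * G) $ n\<bar> \<le> (A * B) $ n"
proof -
  have "\<bar>(F * G) $ n\<bar> \<le> (\<Sum>i=0..n. \<bar>F $ i\<bar> * \<bar>G $ (n - i)\<bar>)"
    unfolding fps_mult_nth by (rule order_trans[OF sum_abs]) (simp add: abs_mult)
  also have "\<dots> \<le> (\<Sum>i=0..n. A $ i * B $ (n - i))"
    using assms by (intro sum_mono mult_mono) (auto intro: order_trans[OF abs_ge_zero])
  finally show ?thesis by (simp add: fps_mult_nth)
qed

lemma fps_nth_power_abs_le: "\<bar>(F ^ j) $ n\<bar> \<le> (fps_abs F ^ j) $ n"
proof (induction j arbitrary: n)
  case (Suc j)
  show ?case unfolding power_Suc by (rule fps_nth_mult_abs_le) (use Suc in auto)
qed (auto simp: fps_one_nth)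

lemma fps_nth_monomial_abs_le:
  "\<bar>(fps_X ^ k * F ^ j) $ n\<bar> \<le> (fps_X ^ k * fps_abs F ^ j) $ n"
  by (rule fps_nth_mult_abs_le) (auto simp: fps_X_power_nth fps_nth_power_abs_le)

lemma geometric_double_abs_summable:
  fixes p q :: real
  assumes "\<bar>p\<bar> < 1" "\<bar>q\<bar> < 1"
  shows "(\<lambda>(k, j). p ^ k * q ^ j) abs_summable_on (UNIV :: (nat \<times> nat) set)"
proof -
  have summ: "(\<lambda>n. \<bar>r ^ n\<bar>) summable_on UNIV" if "\<bar>r\<bar> < 1" for r :: real
    using that by (subst summable_on_UNIV_nonneg_real_iff) (auto simp: power_abs summable_geometric)
  have "(\<lambda>(k, j). p ^ k * q ^ j) abs_summable_on (UNIV \<times> UNIV :: (nat \<times> nat) set)"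
    unfolding Infinite_Sum.abs_summable_on_Sigma_iff
    using summ[OF assms(1)] summ[OF assms(2)]
    by (auto simp: abs_mult infsum_cmult_right' infsum_nonneg
          intro!: summable_on_cmult_right summable_on_cmult_left)
  thus ?thesis by simp
qed

lemma heat_coeff_abs_summable:
  assumes coeff: "\<And>k j. \<bar>heat_coeff \<alpha> k j\<bar> \<le> R ^ (k + j)"
    and "R > 0" "\<bar>t\<bar> < 1 / R" "\<bar>x\<bar> < 1 / R"
  shows "(\<lambda>(k, j). heat_coeff \<alpha> k j * t ^ k * x ^ j) abs_summable_on UNIV"
proof (rule Infinite_Sum.abs_summable_on_comparison_test)
  show "(\<lambda>(k, j). (R * \<bar>t\<bar>) ^ k * (R * \<bar>x\<bar>) ^ j) abs_summable_on UNIV"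
    by (rule geometric_double_abs_summable) (use assms in \<open>auto simp: field_simps abs_mult\<close>)
next
  fix z :: "nat \<times> nat"
  obtain k j where z: "z = (k, j)" by force
  have "\<bar>heat_coeff \<alpha> k j\<bar> * (\<bar>t\<bar> ^ k * \<bar>x\<bar> ^ j) \<le> R ^ (k + j) * (\<bar>t\<bar> ^ k * \<bar>x\<bar> ^ j)"
    by (rule mult_right_mono[OF coeff]) auto
  also have "\<dots> = (R * \<bar>t\<bar>) ^ k * (R * \<bar>x\<bar>) ^ j"
    by (simp add: power_add power_mult_distrib)
  finally show "norm (case z of (k, j) \<Rightarrow> heat_coeff \<alpha> k j * t ^ k * x ^ j)
      \<le> norm (case z of (k, j) \<Rightarrow> (R * \<bar>t\<bar>) ^ k * (R * \<bar>x\<bar>) ^ j)"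
    using \<open>R > 0\<close> by (simp add: z abs_mult power_abs mult.assoc)
qed

lemma heat_eval_has_sum:
  assumes "\<And>k j. \<bar>heat_coeff \<alpha> k j\<bar> \<le> R ^ (k + j)"
    and "R > 0" "\<bar>t\<bar> < 1 / R" "\<bar>x\<bar> < 1 / R"
  shows "((\<lambda>(k, j). heat_coeff \<alpha> k j * t ^ k * x ^ j) has_sum heat_eval \<alpha> t x) UNIV"
  unfolding heat_eval_def
  by (rule has_sum_infsum[OF abs_summable_summable[OF heat_coeff_abs_summable[OF assms]]])

lemma eval_fps_abs_summable:
  assumes "ereal \<bar>t\<bar> < fps_conv_radius F"
  shows "((\<lambda>n. \<bar>F $ n * t ^ n\<bar>) has_sum eval_fps (fps_abs F) \<bar>t\<bar>) UNIV"
    and "((\<lambda>n. F $ n * t ^ n) has_sum eval_fps F t) UNIV"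
proof -
  have "(\<lambda>n. fps_abs F $ n * \<bar>t\<bar> ^ n) sums eval_fps (fps_abs F) \<bar>t\<bar>"
    by (rule sums_eval_fps) (use assms in simp)
  hence *: "(\<lambda>n. \<bar>F $ n * t ^ n\<bar>) sums eval_fps (fps_abs F) \<bar>t\<bar>"
    by (simp add: abs_mult power_abs)
  show "((\<lambda>n. \<bar>F $ n * t ^ n\<bar>) has_sum eval_fps (fps_abs F) \<bar>t\<bar>) UNIV"
    by (rule sums_nonneg_imp_has_sum_strong[OF *]) auto
  show "((\<lambda>n. F $ n * t ^ n) has_sum eval_fps F t) UNIV"
    by (rule norm_summable_imp_has_sum)
       (use * sums_eval_fps[of t F] assms in \<open>auto simp: sums_iff\<close>)
qed

lemma eval_fps_monomial:
  fixes F :: "real fps"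
  assumes "ereal \<bar>t\<bar> < fps_conv_radius F"
  shows "ereal \<bar>t\<bar> < fps_conv_radius (fps_X ^ k * F ^ j)"
    and "eval_fps (fps_X ^ k * F ^ j) t = t ^ k * eval_fps F t ^ j"
proof -
  have r: "ereal \<bar>t\<bar> < fps_conv_radius (F ^ j)"
    using assms fps_conv_radius_power[of F j] by order
  have "min (fps_conv_radius (fps_X ^ k :: real fps)) (fps_conv_radius (F ^ j))
      \<le> fps_conv_radius (fps_X ^ k * F ^ j)"
    by (rule fps_conv_radius_mult)
  thus "ereal \<bar>t\<bar> < fps_conv_radius (fps_X ^ k * F ^ j)"
    using r by (auto simp: min_def split: if_splits)
  show "eval_fps (fps_X ^ k * F ^ j) t = t ^ k * eval_fps F t ^ j"
    using r assms by (simp add: eval_fps_mult eval_fps_power)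
qed

text \<open>
  The formal substitution computes the actual value of the heat series. With \<open>F(t)^j\<close> expanded
  in powers of \<open>t\<close>, the value is a triple series over \<open>k\<close>, \<open>j\<close> and the power of \<open>t\<close>. It converges
  absolutely since replacing \<open>F\<close> by its majorant only requires the double heat series at a larger
  point that is still in the domain of convergence. So the order of summation can be exchanged, and
  then the sum over \<open>k\<close> and \<open>j\<close> at a fixed power of \<open>t\<close> is finite.
\<close>

lemma heat_subst_sums_heat_eval:
  assumes coeff: "\<And>k j. \<bar>heat_coeff \<alpha> k j\<bar> \<le> R ^ (k + j)" and "R > 0" "F $ 0 = 0"
    and t: "ereal \<bar>t\<bar> < fps_conv_radius F" "\<bar>t\<bar> < 1 / R" "eval_fps (fps_abs F) \<bar>t\<bar> < 1 / R"
  shows "(\<lambda>n. heat_subst F \<alpha> $ n * t ^ n) sums heat_eval \<alpha> t (eval_fps F t)"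
proof -
  define h where "h = (\<lambda>((k, j), n). heat_coeff \<alpha> k j * ((fps_X ^ k * F ^ j) $ n * t ^ n))"
  let ?b = "eval_fps (fps_abs F) \<bar>t\<bar>"
  have b: "0 \<le> ?b"
    using eval_fps_abs_summable(1)[OF t(1)] by (rule has_sum_nonneg) auto
  have x: "\<bar>eval_fps F t\<bar> \<le> ?b"
    using norm_infsum_bound[of "\<lambda>n. F $ n * t ^ n" UNIV] eval_fps_abs_summable[OF t(1)]
    by (auto simp: has_sum_iff)
  have inner: "((\<lambda>n. h ((k, j), n)) has_sum heat_coeff \<alpha> k j * t ^ k * eval_fps F t ^ j) UNIV" for k j
    using has_sum_cmult_right[OF eval_fps_abs_summable(2)[OF eval_fps_monomial(1)[OF t(1)]]]
    by (simp add: h_def eval_fps_monomial(2)[OF t(1)] mult.assoc)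
  have t': "ereal \<bar>\<bar>t\<bar>\<bar> < fps_conv_radius (fps_abs F)" using t(1) by simp
  have inner_abs: "(\<lambda>n. \<bar>h ((k, j), n)\<bar>) summable_on UNIV"
     "(\<Sum>\<^sub>\<infinity>n. \<bar>h ((k, j), n)\<bar>) \<le> \<bar>heat_coeff \<alpha> k j * \<bar>t\<bar> ^ k * ?b ^ j\<bar>" for k j
  proof -
    have maj: "((\<lambda>n. \<bar>heat_coeff \<alpha> k j\<bar> * ((fps_X ^ k * fps_abs F ^ j) $ n * \<bar>t\<bar> ^ n)) has_sum
        \<bar>heat_coeff \<alpha> k j\<bar> * (\<bar>t\<bar> ^ k * ?b ^ j)) UNIV"
      using has_sum_cmult_right[OF eval_fps_abs_summable(2)[OF eval_fps_monomial(1)[OF t']]]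
      by (simp add: eval_fps_monomial(2)[OF t'])
    have le: "\<bar>h ((k, j), n)\<bar> \<le> \<bar>heat_coeff \<alpha> k j\<bar> * ((fps_X ^ k * fps_abs F ^ j) $ n * \<bar>t\<bar> ^ n)" for n
      unfolding h_def by (simp add: abs_mult power_abs mult_left_mono mult_right_mono fps_nth_monomial_abs_le)
    show 1: "(\<lambda>n. \<bar>h ((k, j), n)\<bar>) summable_on UNIV"
      by (rule summable_on_comparison_test[OF has_sum_imp_summable[OF maj]]) (use le in auto)
    have "(\<Sum>\<^sub>\<infinity>n. \<bar>h ((k, j), n)\<bar>) \<le> \<bar>heat_coeff \<alpha> k j\<bar> * (\<bar>t\<bar> ^ k * ?b ^ j)"
      by (rule has_sum_mono[OF has_sum_infsum[OF 1] maj]) (use le in auto)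
    thus "(\<Sum>\<^sub>\<infinity>n. \<bar>h ((k, j), n)\<bar>) \<le> \<bar>heat_coeff \<alpha> k j * \<bar>t\<bar> ^ k * ?b ^ j\<bar>"
      using b by (simp add: abs_mult mult.assoc)
  qed
  have "h abs_summable_on (UNIV \<times> UNIV)"
    unfolding Infinite_Sum.abs_summable_on_Sigma_iff
  proof (intro conjI ballI)
    show "(\<lambda>y. h (x, y)) abs_summable_on UNIV" for x
      using inner_abs(1) by (cases x) auto
    show "(\<lambda>x. \<Sum>\<^sub>\<infinity>y. norm (h (x, y))) abs_summable_on UNIV"
    proof (rule Infinite_Sum.abs_summable_on_comparison_test)
      show "(\<lambda>(k, j). heat_coeff \<alpha> k j * \<bar>t\<bar> ^ k * ?b ^ j) abs_summable_on UNIV"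
        by (rule heat_coeff_abs_summable[OF coeff \<open>R > 0\<close>]) (use t b in auto)
      show "norm (\<Sum>\<^sub>\<infinity>y. norm (h (x, y)))
           \<le> norm (case x of (k, j) \<Rightarrow> heat_coeff \<alpha> k j * \<bar>t\<bar> ^ k * ?b ^ j)" for x
        using inner_abs(2) by (cases x) (auto simp: infsum_nonneg)
    qed
  qed
  hence summable: "h summable_on (UNIV \<times> UNIV)"
    by (rule abs_summable_summable)
  have "((\<lambda>(k, j). heat_coeff \<alpha> k j * t ^ k * eval_fps F t ^ j) has_sum
      heat_eval \<alpha> t (eval_fps F t)) UNIV"
    by (rule heat_eval_has_sum[OF coeff \<open>R > 0\<close>]) (use t x in auto)
  hence "(h has_sum heat_eval \<alpha> t (eval_fps F t)) (UNIV \<times> UNIV)"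
    by (intro has_sum_SigmaI[OF _ _ summable, where g = "\<lambda>(k, j). heat_coeff \<alpha> k j * t ^ k * eval_fps F t ^ j"])
       (use inner in auto)
  hence swapped: "((\<lambda>(n, z). h (z, n)) has_sum heat_eval \<alpha> t (eval_fps F t)) (UNIV \<times> UNIV)"
    by (subst (asm) has_sum_swap)
  have "((\<lambda>n. heat_subst F \<alpha> $ n * t ^ n) has_sum heat_eval \<alpha> t (eval_fps F t)) UNIV"
  proof (rule has_sum_SigmaD[OF swapped])
    fix n
    show "((\<lambda>z. case (n, z) of (n, z) \<Rightarrow> h (z, n)) has_sum heat_subst F \<alpha> $ n * t ^ n) UNIV"
    proof (rule has_sum_finite_neutralI)
      show "finite ({..n} \<times> {..n})" by simp
      show "heat_subst F \<alpha> $ n * t ^ n = (\<Sum>z\<in>{..n} \<times> {..n}. case (n, z) of (n, z) \<Rightarrow> h (z, n))"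
        unfolding heat_subst_def fps_nth_Abs_fps heat_partial_nth sum_distrib_right
          sum.cartesian_product h_def
        by (intro sum.cong) (auto simp: mult.assoc)
    next
      fix z :: "nat \<times> nat"
      assume z: "z \<in> UNIV - {..n} \<times> {..n}"
      obtain k j where kj: "z = (k, j)" by force
      have "(fps_X ^ k * F ^ j) $ n = 0"
        by (rule fps_X_power_mult_power_nth_eq_0[OF \<open>F $ 0 = 0\<close>]) (use z kj in auto)
      thus "(case (n, z) of (n, z) \<Rightarrow> h (z, n)) = 0"
        by (simp add: h_def kj)
    qed simp
  qed
  thus ?thesis by (rule has_sum_imp_sums)
qed

lemma heat_subst_has_fps_expansion:
  assumes coeff: "\<And>k j. \<bar>heat_coeff \<alpha> k j\<bar> \<le> R ^ (k + j)" and "R > 0" "F $ 0 = 0"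
    and f: "f has_fps_expansion F"
  shows "(\<lambda>t. heat_eval \<alpha> t (f t)) has_fps_expansion heat_subst F \<alpha>"
proof (rule has_fps_expansionI)
  have radius: "fps_conv_radius F > 0" and ev: "\<forall>\<^sub>F t in nhds 0. eval_fps F t = f t"
    using f by (auto simp: has_fps_expansion_def)
  have "isCont (eval_fps (fps_abs F)) \<bar>0\<bar>"
    using radius by (intro continuous_eval_fps) (simp_all add: zero_ereal_def)
  hence "isCont (\<lambda>t. eval_fps (fps_abs F) \<bar>t\<bar>) 0"
    by (rule isCont_o2[rotated]) simp
  hence "((\<lambda>t. eval_fps (fps_abs F) \<bar>t\<bar>) \<longlongrightarrow> eval_fps (fps_abs F) \<bar>0\<bar>) (nhds 0)"
    by (simp add: tendsto_nhds_iff isCont_def del: abs_zero)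
  hence "\<forall>\<^sub>F t in nhds 0. eval_fps (fps_abs F) \<bar>t\<bar> < 1 / R"
    by (rule order_tendstoD) (simp add: eval_fps_at_0 \<open>F $ 0 = 0\<close> \<open>R > 0\<close>)
  moreover have "\<forall>\<^sub>F t in nhds 0. t \<in> eball 0 (fps_conv_radius F)"
    using radius by (intro eventually_nhds_in_open) (auto simp: zero_ereal_def)
  moreover have "\<forall>\<^sub>F t in nhds 0. t \<in> ball 0 (1 / R)"
    using \<open>R > 0\<close> by (intro eventually_nhds_in_open) auto
  ultimately show "\<forall>\<^sub>F t in nhds 0. (\<lambda>n. heat_subst F \<alpha> $ n * t ^ n) sums heat_eval \<alpha> t (f t)"
    using ev
  proof eventually_elim
    case (elim t)
    thus ?case using heat_subst_sums_heat_eval[OF coeff \<open>R > 0\<close> \<open>F $ 0 = 0\<close>, of t] by auto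
  qed
qed

section \<open>Taylor data of stationary solutions\<close>

definition smooth_upto :: "nat \<Rightarrow> (real \<Rightarrow> real) \<Rightarrow> bool" where
  "smooth_upto n f \<longleftrightarrow> (\<forall>k<n. \<forall>x. (deriv ^^ k) f field_differentiable (at x))"

lemma smooth_upto_deriv:
  assumes "smooth_upto n f" "k < n"
  shows "((deriv ^^ k) f has_real_derivative (deriv ^^ Suc k) f x) (at x)"
  using assms by (simp add: smooth_upto_def field_differentiable_derivI)

text \<open>
  A closed form \<open>g\<close> for the higher derivatives can be verified one derivative at a time.
\<close>

lemma smooth_uptoI:
  assumes "\<And>x. g 0 x = f x"
    and "\<And>k x. k < n \<Longrightarrow> (g k has_real_derivative g (Suc k) x) (at x)"
  shows "smooth_upto n f" and "k \<le> n \<Longrightarrow> (deriv ^^ k) f = g k"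
proof -
  have *: "(deriv ^^ k) f = g k" if "k \<le> n" for k
    using that
  proof (induction k)
    case 0
    show ?case using assms(1) by auto
  next
    case (Suc k)
    hence "(deriv ^^ Suc k) f = deriv (g k)" by simp
    also have "\<dots> = g (Suc k)"
      using assms(2)[of k] Suc.prems by (auto intro!: ext DERIV_imp_deriv)
    finally show ?case .
  qed
  thus "k \<le> n \<Longrightarrow> (deriv ^^ k) f = g k" .
  show "smooth_upto n f"
    unfolding smooth_upto_def field_differentiable_def using * assms(2) by (auto intro!: exI)
qed

text \<open>
  Leibniz's rule for the factor \<open>x\<close>. Applied three times it treats \<open>x^3 \<phi>\<close> and at the same
  time produces three copies of \<open>seq_mult_x\<close> on Taylor data.
\<close>

lemma higher_deriv_mult_x:
  assumes "smooth_upto n f"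
  shows "smooth_upto n (\<lambda>x. x * f x)"
    and "k \<le> n \<Longrightarrow> (deriv ^^ k) (\<lambda>x. x * f x) =
           (\<lambda>x. x * (deriv ^^ k) f x + real k * (deriv ^^ (k - 1)) f x)"
proof -
  define g where "g = (\<lambda>k x. x * (deriv ^^ k) f x + real k * (deriv ^^ (k - 1)) f x)"
  have "(g k has_real_derivative g (Suc k) x) (at x)" if "k < n" for k x
  proof (cases k)
    case 0
    thus ?thesis unfolding g_def
      using that by (auto intro!: derivative_eq_intros smooth_upto_deriv[OF assms, of 0, simplified])
  next
    case (Suc m)
    thus ?thesis unfolding g_def
      using that by (auto simp: algebra_simps simp del: funpow.simps
          intro!: derivative_eq_intros smooth_upto_deriv[OF assms])
  qed
  from smooth_uptoI[of g "\<lambda>x. x * f x" n, OF _ this]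
  show "smooth_upto n (\<lambda>x. x * f x)"
    and "k \<le> n \<Longrightarrow> (deriv ^^ k) (\<lambda>x. x * f x) =
           (\<lambda>x. x * (deriv ^^ k) f x + real k * (deriv ^^ (k - 1)) f x)"
    by (auto simp: g_def)
qed

lemma higher_deriv_cmult_smooth:
  assumes "smooth_upto n f"
  shows "smooth_upto n (\<lambda>x. c * f x)"
    and "k \<le> n \<Longrightarrow> (deriv ^^ k) (\<lambda>x. c * f x) = (\<lambda>x. c * (deriv ^^ k) f x)"
proof -
  define g where "g = (\<lambda>k x. c * (deriv ^^ k) f x)"
  have "(g k has_real_derivative g (Suc k) x) (at x)" if "k < n" for k x
    unfolding g_def by (intro DERIV_cmult smooth_upto_deriv[OF assms that])
  from smooth_uptoI[of g "\<lambda>x. c * f x" n, OF _ this]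
  show "smooth_upto n (\<lambda>x. c * f x)"
    and "k \<le> n \<Longrightarrow> (deriv ^^ k) (\<lambda>x. c * f x) = (\<lambda>x. c * (deriv ^^ k) f x)"
    by (auto simp: g_def)
qed

lemma stationary_solution_fourth_deriv:
  assumes "stationary_solution \<rho> \<phi>"
  shows "(deriv ^^ 4) \<phi> = (\<lambda>x. - \<rho> * (x * (x * (x * \<phi> x))))"
  using assms unfolding stationary_solution_def
  by (auto simp: fun_eq_iff power3_eq_cube eq_neg_iff_add_eq_0 mult.assoc)

text \<open>
  Bootstrapping: the equation expresses the fourth derivative through \<open>x^3 \<phi>\<close>, which has as many
  derivatives as \<open>\<phi>\<close>.
\<close>

lemma stationary_solution_smooth:
  assumes "stationary_solution \<rho> \<phi>"
  shows "smooth_upto n \<phi>"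
proof (induction n)
  case (Suc n)
  have "smooth_upto n ((deriv ^^ 4) \<phi>)"
    unfolding stationary_solution_fourth_deriv[OF assms]
    by (intro higher_deriv_cmult_smooth higher_deriv_mult_x Suc)
  hence high: "(deriv ^^ (k + 4)) \<phi> field_differentiable (at x)" if "k < n" for k x
    using that by (simp add: smooth_upto_def funpow_add)
  have low: "(deriv ^^ k) \<phi> field_differentiable (at x)" if "k < 4" for k x
    using assms that by (simp add: stationary_solution_def)
  show ?case
    unfolding smooth_upto_def
  proof (intro allI impI)
    fix k x assume "k < Suc n"
    thus "(deriv ^^ k) \<phi> field_differentiable (at x)"
      using low[of k x] high[of "k - 4" x] by (cases "k < 4") auto
  qed
qed (simp add: smooth_upto_def)

lemma stationary_solution_recurrence:
  assumes "stationary_solution \<rho> \<phi>"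
  defines "\<alpha> \<equiv> \<lambda>n. (deriv ^^ n) \<phi> 0"
  shows "\<alpha> (n + 4) = - \<rho> * seq_mult_x (seq_mult_x (seq_mult_x \<alpha>)) n"
proof -
  note smooth = stationary_solution_smooth[OF assms(1), of n]
  have mult: "(deriv ^^ k) (\<lambda>x. x * f x) 0 = seq_mult_x (\<lambda>k. (deriv ^^ k) f 0) k"
    if "smooth_upto n f" "k \<le> n" for f k
    using higher_deriv_mult_x(2)[OF that] by (simp add: seq_mult_x_def)
  have "\<alpha> (n + 4) = (deriv ^^ n) ((deriv ^^ 4) \<phi>) 0"
    by (simp add: \<alpha>_def funpow_add)
  also have "\<dots> = - \<rho> * (deriv ^^ n) (\<lambda>x. x * (x * (x * \<phi> x))) 0"
    unfolding stationary_solution_fourth_deriv[OF assms(1)]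
    by (subst higher_deriv_cmult_smooth(2)[where n = n]) (intro higher_deriv_mult_x smooth | simp)+
  also have "(deriv ^^ n) (\<lambda>x. x * (x * (x * \<phi> x))) 0 = seq_mult_x (seq_mult_x (seq_mult_x \<alpha>)) n"
    by (simp add: mult higher_deriv_mult_x(1) smooth seq_mult_x_def \<alpha>_def)
  finally show ?thesis .
qed

lemma seq_mult_x3:
  "seq_mult_x (seq_mult_x (seq_mult_x \<alpha>)) n =
     real n * real (n - 1) * real (n - 2) * \<alpha> (n - 3)"
  by (simp add: seq_mult_x_def numeral_2_eq_2 numeral_3_eq_3)

text \<open>
  The sequence determined by the equation \<open>\<phi>'''' = - \<rho> x^3 \<phi>\<close> decouples into residue classes
  modulo 7, of which those of 4, 5 and 6 vanish.
\<close>

lemma stationary_seq_step_seven: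
  fixes \<alpha> :: "nat \<Rightarrow> real"
  assumes rec: "\<And>n. \<alpha> (n + 4) = - \<rho> * seq_mult_x (seq_mult_x (seq_mult_x \<alpha>)) n"
  shows "\<alpha> (n + 7) = - \<rho> * (real (n + 1) * real (n + 2) * real (n + 3)) * \<alpha> n"
    and "n \<in> {4, 5, 6} \<Longrightarrow> \<alpha> n = 0"
  using rec[of "n + 3"] rec[of 0] rec[of 1] rec[of 2]
  by (auto simp: seq_mult_x3 add.assoc)

lemma stationary_seq_support:
  fixes \<alpha> :: "nat \<Rightarrow> real"
  assumes rec: "\<And>n. \<alpha> (n + 4) = - \<rho> * seq_mult_x (seq_mult_x (seq_mult_x \<alpha>)) n"
    and init: "\<And>n. n < 4 \<Longrightarrow> n \<noteq> r \<Longrightarrow> \<alpha> n = 0"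
  shows "n mod 7 \<noteq> r \<Longrightarrow> \<alpha> n = 0"
proof (induction n rule: less_induct)
  case (less n)
  consider "n < 4" | "n \<in> {4, 5, 6}" | m where "n = m + 7"
  proof -
    have "n < 4 \<or> n \<in> {4, 5, 6} \<or> n \<ge> 7" by auto
    thus thesis using that le_Suc_ex[of 7 n] by (metis add.commute)
  qed
  thus ?case
  proof cases
    case 1
    thus ?thesis using init less.prems by auto
  next
    case 2
    thus ?thesis by (rule stationary_seq_step_seven(2)[OF rec])
  next
    case (3 m)
    hence "\<alpha> m = 0" using less.IH[of m] less.prems by auto
    thus ?thesis using stationary_seq_step_seven(1)[OF rec, of m] 3 by simp
  qed
qed

text \<open>
  Seven steps gain the factor \<open>(n+1)(n+2)(n+3)\<close>, whereas \<open>n!\<close> gains seven factors. The four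
  factors in surplus pay for the at most four new factors of \<open>(n div 2)!\<close>.
\<close>

lemma stationary_seq_growth:
  fixes \<alpha> :: "nat \<Rightarrow> real"
  assumes rec: "\<And>n. \<alpha> (n + 4) = - \<rho> * seq_mult_x (seq_mult_x (seq_mult_x \<alpha>)) n"
    and init: "\<And>n. n < 4 \<Longrightarrow> \<bar>\<alpha> n\<bar> \<le> 1"
  shows "\<bar>\<alpha> n\<bar> * fact (n div 2) \<le> (1 + \<bar>\<rho>\<bar>) ^ n * fact n"
proof (induction n rule: less_induct)
  case (less n)
  show ?case
  proof (cases "n < 7")
    case True
    have "\<bar>\<alpha> n\<bar> \<le> 1"
    proof (cases "n < 4")
      case False
      with True have "n \<in> {4, 5, 6}" by auto
      from stationary_seq_step_seven(2)[OF rec this] show ?thesis by simp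
    qed (rule init)
    moreover have "(fact (n div 2) :: real) \<le> fact n"
      by (rule fact_mono) simp
    moreover have "1 \<le> (1 + \<bar>\<rho>\<bar>) ^ n" by (rule one_le_power) simp
    ultimately have "\<bar>\<alpha> n\<bar> * fact (n div 2) \<le> 1 * fact n" "1 * fact n \<le> (1 + \<bar>\<rho>\<bar>) ^ n * (fact n :: real)"
      by (intro mult_mono mult_right_mono; simp)+
    thus ?thesis by linarith
  next
    case False
    then obtain m where n: "n = m + 7" by (metis add.commute le_Suc_ex linorder_not_le)
    define h where "h = m div 2"
    define P where "P = real (m + 1) * real (m + 2) * real (m + 3)"
    define Q where "Q = real (m + 4) * real (m + 5) * real (m + 6) * real (m + 7)"
    have P: "P \<ge> 0" and Q: "Q \<ge> 0" by (simp_all add: P_def Q_def)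
    \<comment> \<open>\<open>(m + 7) div 2\<close> exceeds \<open>m div 2\<close> by 3 or 4, depending on parity.\<close>
    have "(fact (n div 2) :: real) \<le> fact (h + 4)"
      by (rule fact_mono) (simp add: n h_def)
    also have "\<dots> = real (h + 1) * real (h + 2) * real (h + 3) * real (h + 4) * fact h"
      by (simp add: numeral_eq_Suc algebra_simps)
    also have "\<dots> \<le> Q * fact h"
      unfolding Q_def by (intro mult_right_mono mult_mono) (auto simp: h_def)
    finally have f: "fact (n div 2) \<le> Q * (fact h :: real)" .
    have "\<bar>\<alpha> n\<bar> * fact (n div 2) = \<bar>\<rho>\<bar> * P * \<bar>\<alpha> m\<bar> * fact (n div 2)"
      using stationary_seq_step_seven(1)[OF rec, of m] by (simp add: n P_def abs_mult)
    also have "\<dots> \<le> \<bar>\<rho>\<bar> * P * \<bar>\<alpha> m\<bar> * (Q * fact h)"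
      using P by (intro mult_left_mono f) auto
    also have "\<dots> = \<bar>\<rho>\<bar> * (P * Q) * (\<bar>\<alpha> m\<bar> * fact h)" by simp
    also have "\<dots> \<le> (1 + \<bar>\<rho>\<bar>) ^ 7 * (P * Q) * ((1 + \<bar>\<rho>\<bar>) ^ m * fact m)"
    proof (rule mult_mono[OF mult_right_mono])
      have "\<bar>\<rho>\<bar> \<le> (1 + \<bar>\<rho>\<bar>) ^ 1" by simp
      also have "\<dots> \<le> (1 + \<bar>\<rho>\<bar>) ^ 7" by (rule power_increasing) auto
      finally show "\<bar>\<rho>\<bar> \<le> (1 + \<bar>\<rho>\<bar>) ^ 7" .
      show "\<bar>\<alpha> m\<bar> * fact h \<le> (1 + \<bar>\<rho>\<bar>) ^ m * fact m"
        using less.IH[of m] by (simp add: n h_def)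
    qed (use P Q in auto)
    also have "\<dots> = (1 + \<bar>\<rho>\<bar>) ^ n * (P * Q * fact m)"
      by (simp add: n power_add)
    also have "P * Q * fact m = fact n"
      by (simp add: n P_def Q_def numeral_eq_Suc algebra_simps)
    finally show ?thesis .
  qed
qed

lemma fact_add_le: "(fact (a + b) :: real) \<le> 2 ^ (a + b) * (fact a * fact b)"
proof -
  have "(fact (a + b) :: real) = fact a * fact b * real (a + b choose a)"
    using binomial_fact_lemma[of a "a + b"] by (metis add_diff_cancel_left' le_add1 of_nat_fact of_nat_mult)
  also have "real (a + b choose a) \<le> 2 ^ (a + b)"
    using binomial_le_pow2[of "a + b" a] by (metis of_nat_le_iff of_nat_numeral of_nat_power)
  finally show ?thesis by (simp add: mult_ac)
qed

text \<open>
  The heat coefficients contain the large quotient \<open>(j+2k)! / (j! k!)\<close>, which exceeds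
  binomial coefficients by a factor \<open>k!\<close>. That factor is absorbed by \<open>((j+2k) div 2)!\<close>, so the
  growth of \<open>\<alpha>\<close> is slow enough for convergence.
\<close>

lemma heat_coeff_growth:
  assumes K: "K \<ge> 1" and growth: "\<And>n. \<bar>\<alpha> n\<bar> * fact (n div 2) \<le> K ^ n * fact n"
  shows "\<bar>heat_coeff \<alpha> k j\<bar> \<le> (16 * K\<^sup>2) ^ (k + j)"
proof -
  define n where "n = j + 2 * k"
  have kn: "2 * k \<le> n" by (simp add: n_def)
  have bin1: "(fact n :: real) \<le> 2 ^ n * (fact j * fact (2 * k))"
    using fact_add_le[of j "2 * k"] by (simp add: n_def)
  have bin2: "(fact (2 * k) :: real) \<le> 2 ^ (2 * k) * (fact k * fact k)"
    using fact_add_le[of k k] by (simp add: mult_2)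
  have "(fact n :: real) \<le> 2 ^ n * (fact j * (2 ^ (2 * k) * (fact k * fact k)))"
    using bin1 by (rule order_trans) (intro mult_left_mono bin2, auto)
  also have "\<dots> \<le> 2 ^ n * (fact j * (2 ^ n * (fact k * fact (n div 2))))"
    using kn by (intro mult_left_mono mult_mono power_increasing fact_mono) auto
  finally have fact_le: "(fact n :: real) \<le> 4 ^ n * (fact j * fact k * fact (n div 2))"
    using power_mult_distrib[of "2 :: real" 2 n] by (simp add: mult_ac)
  have "\<bar>\<alpha> n\<bar> * fact (n div 2) \<le> K ^ n * (4 ^ n * (fact j * fact k * fact (n div 2)))"
    by (rule order_trans[OF growth]) (intro mult_left_mono fact_le, use K in auto)
  hence "\<bar>\<alpha> n\<bar> \<le> (4 * K) ^ n * (fact j * fact k)"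
    by (simp add: power_mult_distrib mult_ac)
  also have "\<dots> \<le> (4 * K) ^ n * (fact j * fact k * 2 ^ k)"
    using K by (intro mult_left_mono) auto
  finally have "\<bar>heat_coeff \<alpha> k j\<bar> \<le> (4 * K) ^ n"
    by (simp add: heat_coeff_def n_def abs_mult field_simps)
  also have "\<dots> \<le> (4 * K) ^ (2 * (k + j))"
    using K by (intro power_increasing) (auto simp: n_def)
  also have "\<dots> = ((4 * K)\<^sup>2) ^ (k + j)" by (rule power_mult)
  also have "\<dots> = (16 * K\<^sup>2) ^ (k + j)" by (simp add: power_mult_distrib)
  finally show ?thesis .
qed

section \<open>Analyticity of the heat transform\<close>

lemma heat_term_eq:
  "heat_term \<phi> t x n =
     (\<Sum>k=0..n div 2. heat_coeff (\<lambda>n. (deriv ^^ n) \<phi> 0) k (n - 2 * k) * t ^ k * x ^ (n - 2 * k))"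
  unfolding heat_term_def heat_monomial_def sum_distrib_left
  by (intro sum.cong refl) (simp add: heat_coeff_def power_divide)

text \<open>
  The series over \<open>n\<close> in the definition of the heat transform groups the double series along
  the finite fibres of \<open>n = j + 2 k\<close>.
\<close>

lemma heat_term_sums_heat_eval:
  fixes \<phi> :: "real \<Rightarrow> real"
  defines "\<alpha> \<equiv> \<lambda>n. (deriv ^^ n) \<phi> 0"
  assumes "((\<lambda>(k, j). heat_coeff \<alpha> k j * t ^ k * x ^ j) has_sum S) UNIV"
  shows "heat_term \<phi> t x sums S"
proof -
  define f where "f = (\<lambda>(k, j). heat_coeff \<alpha> k j * t ^ k * x ^ j)"
  have bij: "bij_betw (\<lambda>(n, k). (k, n - 2 * k)) (SIGMA n:UNIV. {0..n div 2}) (UNIV :: (nat \<times> nat) set)"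
    by (rule bij_betwI[where g = "\<lambda>(k, j). (j + 2 * k, k)"]) auto
  have "(f has_sum S) UNIV" using assms(2) by (simp add: f_def)
  hence "((\<lambda>(n, k). f (k, n - 2 * k)) has_sum S) (SIGMA n:UNIV. {0..n div 2})"
    using has_sum_reindex_bij_betw[OF bij, of f S] by (simp add: case_prod_unfold)
  hence "(heat_term \<phi> t x has_sum S) UNIV"
    by (rule has_sum_SigmaD) (auto simp: heat_term_eq f_def \<alpha>_def intro!: has_sum_finiteI)
  thus ?thesis by (rule has_sum_imp_sums)
qed

lemma heat_transform_eq_heat_eval:
  fixes \<phi> :: "real \<Rightarrow> real"
  defines "\<alpha> \<equiv> \<lambda>n. (deriv ^^ n) \<phi> 0"
  assumes "\<And>k j. \<bar>heat_coeff \<alpha> k j\<bar> \<le> R ^ (k + j)" "R > 0" "\<bar>t\<bar> < 1 / R" "\<bar>x\<bar> < 1 / R"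
  shows "summable (heat_term \<phi> t x)" "heat_transform \<phi> t x = heat_eval \<alpha> t x"
  using heat_term_sums_heat_eval[of \<phi> t x, OF heat_eval_has_sum[OF assms(2-5), unfolded \<alpha>_def]]
  by (auto simp: heat_transform_def sums_iff \<alpha>_def)

lemma heat_transform_analytic:
  fixes \<phi> :: "real \<Rightarrow> real"
  defines "\<alpha> \<equiv> \<lambda>n. (deriv ^^ n) \<phi> 0"
  assumes coeff: "\<And>k j. \<bar>heat_coeff \<alpha> k j\<bar> \<le> R ^ (k + j)" and "R > 0"
  shows "\<forall>\<^sub>F (t, x) in nhds (0, 0). summable (heat_term \<phi> t x)"
    and "analytic_near_origin (heat_transform \<phi>)"
proof -
  have "\<forall>\<^sub>F z in nhds (0, 0). z \<in> ball 0 (1 / R) \<times> ball 0 (1 / R)"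
    using \<open>R > 0\<close> by (intro eventually_nhds_in_open open_Times) auto
  thus "\<forall>\<^sub>F (t, x) in nhds (0, 0). summable (heat_term \<phi> t x)"
    by eventually_elim
       (use heat_transform_eq_heat_eval(1)[of \<phi> R, folded \<alpha>_def, OF coeff \<open>R > 0\<close>] in auto)
  show "analytic_near_origin (heat_transform \<phi>)"
    unfolding analytic_near_origin_def
  proof (intro exI conjI allI impI)
    show "1 / R > 0" using \<open>R > 0\<close> by simp
    show "((\<lambda>(i, j). heat_coeff \<alpha> i j * t ^ i * x ^ j) has_sum heat_transform \<phi> t x) UNIV"
      if "\<bar>t\<bar> < 1 / R" "\<bar>x\<bar> < 1 / R" for t x
      using heat_eval_has_sum[OF coeff \<open>R > 0\<close> that]
        heat_transform_eq_heat_eval(2)[of \<phi> R, folded \<alpha>_def, OF coeff \<open>R > 0\<close> that] by simp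
  qed
qed

section \<open>The linear system along a curve and its determinant\<close>

text \<open>
  The polynomial behind the nonlinear operator \<open>\<E>\<close>, over an arbitrary ring so that it
  can be evaluated at functions and at formal power series alike.
\<close>

definition det_poly :: "'a :: comm_ring_1 \<Rightarrow> 'a \<Rightarrow> 'a \<Rightarrow> 'a \<Rightarrow> 'a \<Rightarrow> 'a" where
  "det_poly z p a b c =
       240 + 8*c - 72*b + 3*b^2 + 48*a - 2*a*c
       + z * (- 512*b + 192*a*b + 384*a^2 - 48*a^2*b - 48*a^3 + 4*a^3*b
              + 192*p*b - 768*p*a + 48*p*a^2 + 240*p^2 - 24*p^2*b + 12*p^2*a)
       + z^2 * (512*a^3 - 192*a^4 + 24*a^5 - a^6 - 1536*p*a^2 + 384*p*a^3 - 24*p*a^4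
                + 1536*p^2*a - 192*p^2*a^2 - 512*p^3 - 32*p^3*a + 4*p^3*a^2 + 36*p^4)"

text \<open>
  Along \<open>x = F(t)\<close> the derivatives \<open>2 W', 4 W'', 8 W'''\<close> of \<open>W = v(t, F)\<close> are linear in the
  values of \<open>v, v_x, v_xx, v_xxx\<close>. The coefficients of \<open>v_x, v_xx, v_xxx\<close> form a 3 by 3 matrix.
  Its cofactors along the column of \<open>v_x\<close> combine the three rows so that \<open>v_xx\<close> and \<open>v_xxx\<close>
  disappear. After cancelling a common factor the cofactors are \<open>x^3 (a - 4)\<close>,
  \<open>x^2 elim2\<close> and \<open>x elim1\<close>, and \<open>elim0\<close> compensates the contributions of \<open>v\<close> itself.
\<close>

definition elim2 :: "'a :: comm_ring_1 \<Rightarrow> 'a \<Rightarrow> 'a \<Rightarrow> 'a \<Rightarrow> 'a" where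
  "elim2 z p a b = 3 * (12 - b)
     + z * (512 - 192*a + 24*a^2 - a^3 - 192*p + 36*p*a + 6*p^2)"

definition elim1 :: "'a :: comm_ring_1 \<Rightarrow> 'a \<Rightarrow> 'a \<Rightarrow> 'a \<Rightarrow> 'a" where
  "elim1 z p a b =
     z * (6 * (512 - 320*a + 8*a*b + 36*a^2 - a^2*b + 64*p - 12*p*b + 20*p*a)
     + 2 * z * (- 512*a^2 + 192*a^3 - 24*a^4 + a^5 + 1536*p*a - 384*p*a^2 + 24*p*a^3
         - 768*p^2 - 96*p^2*a + 30*p^2*a^2 + 64*p^3 + 2*p^3*a))"

definition elim0 :: "'a :: comm_ring_1 \<Rightarrow> 'a \<Rightarrow> 'a \<Rightarrow> 'a \<Rightarrow> 'a" where
  "elim0 z p a b =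
     z * (24 * (64 - 40*a + 6*a^2 + 28*p - 3*p*b + 2*p*a)
     + 12 * z * p * (256*a - 96*a^2 + 10*a^3 - 128*p - 16*p*a + 6*p*a^2 + 24*p^2 - p^2*b)
     + 4 * z^2 * p^3 * (128*a - 48*a^2 + 5*a^3 - 96*p + 12*p*a + 6*p^2))"

text \<open>
  The determinant of the linear system is a monomial in \<open>k\<close> and \<open>x\<close> times \<open>det_poly\<close>. The variables
  stand for \<open>x = t\<close>, \<open>k = \<rho> / 16\<close>, for the curve and its derivatives
  \<open>f, f1, f2, f3\<close>, and for the \<open>x\<close>-derivatives \<open>w0, ..., w6\<close> of \<open>v\<close> along the curve. The
  stationary equation reduces \<open>w4, w5, w6\<close> to the first four.
\<close>

lemma boundary_elimination:
  fixes k x p a b c w0 w1 w2 w3 w4 w5 w6 :: "'a :: idom"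
  assumes f: "f = k * x^4 * p" "f1 = k * x^3 * a" "f2 = k * x^2 * b" "f3 = k * x * c"
    and w4: "w4 = - (16 * k) * ((f^3 + 3*f*x) * w0 + (3*f^2*x + 3*x^2) * w1
                 + 3*f*x^2 * w2 + x^3 * w3)"
    and w5: "w5 = - (16 * k) * ((f^3 + 3*f*x) * w1 + (3*f^2*x + 3*x^2) * w2
                 + 3*f*x^2 * w3 + x^3 * w4
                 + 3 * ((f^2 + x) * w0 + 2*f*x * w1 + x^2 * w2))"
    and w6: "w6 = - (16 * k) * ((f^3 + 3*f*x) * w2 + (3*f^2*x + 3*x^2) * w3
                 + 3*f*x^2 * w4 + x^3 * w5
                 + 6 * ((f^2 + x) * w1 + 2*f*x * w2 + x^2 * w3) + 6 * (f * w0 + x * w1))"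
    and d1: "d1 = 2*f1*w1 + w2"
    and d2: "d2 = 4*f2*w1 + 4*f1^2*w2 + 4*f1*w3 + w4"
    and d3: "d3 = 8*f3*w1 + 24*f1*f2*w2 + (12*f2 + 8*f1^3)*w3 + 12*f1^2*w4 + 6*f1*w5 + w6"
  defines "z \<equiv> 2 * k^2 * x^7"
  shows "x^3 * (a - 4) * d3 + x^2 * elim2 z p a b * d2 + x * elim1 z p a b * d1
         + elim0 z p a b * w0 = - 4 * k * x^4 * det_poly z p a b c * w1"
  unfolding d1 d2 d3 w6 w5 w4 f z_def elim2_def elim1_def elim0_def det_poly_def
  by algebra

lemma fps_mult_nth_leading:
  fixes A T :: "'a :: comm_ring_1 fps"
  assumes "\<And>i. i < M \<Longrightarrow> A $ i = 0" "\<And>i. i < N \<Longrightarrow> T $ i = 0"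
  shows "(A * T) $ (N + M) = A $ M * T $ N"
proof -
  have "A $ i * T $ (N + M - i) = 0" if "i \<noteq> M" "i \<le> N + M" for i
    using assms(1)[of i] assms(2)[of "N + M - i"] that by (cases "i < M") auto
  hence "(A * T) $ (N + M) = (\<Sum>i\<in>{M}. A $ i * T $ (N + M - i))"
    unfolding fps_mult_nth by (intro sum.mono_neutral_right) auto
  thus ?thesis by simp
qed

lemma euler_op_nth:
  fixes W :: "real fps"
  shows "(fps_X * fps_deriv W) $ n = real n * W $ n"
    and "(fps_X ^ 2 * fps_deriv (fps_deriv W)) $ n = real n * (real n - 1) * W $ n"
    and "(fps_X ^ 3 * fps_deriv (fps_deriv (fps_deriv W))) $ n =
           real n * (real n - 1) * (real n - 2) * W $ n"
proof -
  show "(fps_X * fps_deriv W) $ n = real n * W $ n" by (cases n) auto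
  show "(fps_X ^ 2 * fps_deriv (fps_deriv W)) $ n = real n * (real n - 1) * W $ n"
  proof -
    consider "n = 0" | "n = 1" | m where "n = m + 2"
      by (metis One_nat_def add_2_eq_Suc' not0_implies_Suc)
    thus ?thesis by cases (auto simp: fps_X_power_mult_nth)
  qed
  show "(fps_X ^ 3 * fps_deriv (fps_deriv (fps_deriv W))) $ n =
           real n * (real n - 1) * (real n - 2) * W $ n"
  proof -
    have "n = 0 \<or> n = 1 \<or> n = 2 \<or> (\<exists>m. n = m + 3)" by presburger
    then consider "n = 0" | "n = 1" | "n = 2" | m where "n = m + 3" by blast
    thus ?thesis
      by cases (simp_all add: fps_X_power_mult_nth, simp add: numeral_3_eq_3 algebra_simps)
  qed
qed

text \<open>
  A linear differential equation with a regular singular point at 0 has no nonzero power series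
  solution that avoids the roots of its indicial polynomial: that polynomial multiplies the lowest
  coefficient of the solution. The common order of vanishing \<open>M\<close> of the coefficients is split off.
\<close>

lemma euler_equation_zero:
  fixes W A0 A1 A2 A3 :: "real fps"
  assumes eq: "A3 * (fps_X ^ 3 * fps_deriv (fps_deriv (fps_deriv W)))
      + A2 * (fps_X ^ 2 * fps_deriv (fps_deriv W)) + A1 * (fps_X * fps_deriv W) + A0 * W = 0"
    and small: "\<And>i. i < M \<Longrightarrow> A3 $ i = 0" "\<And>i. i < M \<Longrightarrow> A2 $ i = 0"
       "\<And>i. i < M \<Longrightarrow> A1 $ i = 0" "\<And>i. i < M \<Longrightarrow> A0 $ i = 0"
    and indicial: "\<And>n. W $ n \<noteq> 0 \<Longrightarrow>
       A3 $ M * (real n * (real n - 1) * (real n - 2)) + A2 $ M * (real n * (real n - 1))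
       + A1 $ M * real n + A0 $ M \<noteq> 0"
  shows "W = 0"
proof (rule ccontr)
  assume "W \<noteq> 0"
  define N where "N = subdegree W"
  have WN: "W $ N \<noteq> 0" using \<open>W \<noteq> 0\<close> by (simp add: N_def)
  have low: "W $ i = 0" if "i < N" for i
    using that nth_less_subdegree_zero by (auto simp: N_def)
  have "0 = (A3 * (fps_X ^ 3 * fps_deriv (fps_deriv (fps_deriv W)))
      + A2 * (fps_X ^ 2 * fps_deriv (fps_deriv W)) + A1 * (fps_X * fps_deriv W) + A0 * W) $ (N + M)"
    using eq by simp
  also have "\<dots> = (A3 $ M * (real N * (real N - 1) * (real N - 2)) + A2 $ M * (real N * (real N - 1))
       + A1 $ M * real N + A0 $ M) * W $ N"
    unfolding fps_add_nth
    by (subst (1 2 3 4) fps_mult_nth_leading) (simp_all only: small low euler_op_nth mult_zero_right, simp add: algebra_simps)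
  finally show False using indicial[OF WN] WN by simp
qed

text \<open>
  Repeated use of \<open>2 (W i)' = W (i + 2) + 2 F' W (i + 1)\<close>, where \<open>W i\<close> is the \<open>i\<close>-th
  \<open>x\<close>-derivative of \<open>v\<close> along the curve. The powers of 2 on the left keep all coefficients
  integral.
\<close>

lemma heat_subst_derivs:
  fixes F :: "real fps" and \<alpha>
  assumes "F $ 0 = 0"
  defines "W \<equiv> \<lambda>i. heat_subst F ((seq_shift ^^ i) \<alpha>)"
  defines "F1 \<equiv> fps_deriv F"
  defines "F2 \<equiv> fps_deriv F1"
  defines "F3 \<equiv> fps_deriv F2"
  shows "2 * fps_deriv (W 0) = 2 * F1 * W 1 + W 2"
    and "4 * fps_deriv (fps_deriv (W 0)) = 4 * F2 * W 1 + 4 * F1^2 * W 2 + 4 * F1 * W 3 + W 4"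
    and "8 * fps_deriv (fps_deriv (fps_deriv (W 0))) = 8 * F3 * W 1 + 24 * F1 * F2 * W 2
           + (12 * F2 + 8 * F1^3) * W 3 + 12 * F1^2 * W 4 + 6 * F1 * W 5 + W 6"
proof -
  have dW: "2 * fps_deriv (W i) = W (i + 2) + 2 * F1 * W (i + 1)" for i
  proof -
    have "2 * fps_deriv (W i) = 2 * fps_const (1/2) * W (i + 2) + 2 * F1 * W (i + 1)"
      unfolding W_def F1_def fps_deriv_heat_subst[OF assms(1)] by (simp add: algebra_simps)
    also have "2 * fps_const (1/2) = (1 :: real fps)"
      by (simp add: numeral_fps_const)
    finally show ?thesis by simp
  qed
  have dnum: "fps_deriv (numeral m * G) = numeral m * fps_deriv G" for m and G :: "real fps"
    by (simp add: numeral_fps_const)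
  show 1: "2 * fps_deriv (W 0) = 2 * F1 * W 1 + W 2"
    using dW[of 0] by (simp add: numeral_eq_Suc)
  have e1: "2 * fps_deriv (W 1) = W 3 + 2 * F1 * W 2" and e2: "2 * fps_deriv (W 2) = W 4 + 2 * F1 * W 3"
    and e3: "2 * fps_deriv (W 3) = W 5 + 2 * F1 * W 4" and e4: "2 * fps_deriv (W 4) = W 6 + 2 * F1 * W 5"
    using dW[of 1] dW[of 2] dW[of 3] dW[of 4] by (simp_all add: numeral_eq_Suc)
  have "2 * fps_deriv (fps_deriv (W 0)) = fps_deriv (2 * F1 * W 1 + W 2)"
    using arg_cong[OF 1, of fps_deriv] by (simp only: dnum)
  also have "\<dots> = 2 * F2 * W 1 + 2 * F1 * fps_deriv (W 1) + fps_deriv (W 2)"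
    by (simp add: mult.assoc dnum F2_def)
  finally have "4 * fps_deriv (fps_deriv (W 0)) = 4 * F2 * W 1 + 2 * F1 * (2 * fps_deriv (W 1)) + 2 * fps_deriv (W 2)"
    by algebra
  thus 2: "4 * fps_deriv (fps_deriv (W 0)) = 4 * F2 * W 1 + 4 * F1^2 * W 2 + 4 * F1 * W 3 + W 4"
    unfolding e1 e2 by algebra
  have "4 * fps_deriv (fps_deriv (fps_deriv (W 0))) =
      fps_deriv (4 * F2 * W 1 + 4 * F1^2 * W 2 + 4 * F1 * W 3 + W 4)"
    using arg_cong[OF 2, of fps_deriv] by (simp only: dnum)
  also have "\<dots> = 4 * F3 * W 1 + 4 * F2 * fps_deriv (W 1) + 8 * F1 * F2 * W 2 + 4 * F1^2 * fps_deriv (W 2)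
      + 4 * F2 * W 3 + 4 * F1 * fps_deriv (W 3) + fps_deriv (W 4)"
    by (simp add: mult.assoc dnum F2_def F3_def power2_eq_square) (simp add: algebra_simps)
  finally have "8 * fps_deriv (fps_deriv (fps_deriv (W 0))) =
      8 * F3 * W 1 + 4 * F2 * (2 * fps_deriv (W 1)) + 16 * F1 * F2 * W 2 + 4 * F1^2 * (2 * fps_deriv (W 2))
      + 8 * F2 * W 3 + 4 * F1 * (2 * fps_deriv (W 3)) + 2 * fps_deriv (W 4)"
    by algebra
  thus "8 * fps_deriv (fps_deriv (fps_deriv (W 0))) = 8 * F3 * W 1 + 24 * F1 * F2 * W 2
           + (12 * F2 + 8 * F1^3) * W 3 + 12 * F1^2 * W 4 + 6 * F1 * W 5 + W 6"
    unfolding e1 e2 e3 e4 by algebra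
qed

lemma seq_mult_x_add: "seq_mult_x (\<lambda>n. \<alpha> n + \<beta> n) = (\<lambda>n. seq_mult_x \<alpha> n + seq_mult_x \<beta> n)"
  by (simp add: seq_mult_x_def fun_eq_iff distrib_left)

lemma seq_mult_x_cmult: "seq_mult_x (\<lambda>n. c * \<alpha> n) = (\<lambda>n. c * seq_mult_x \<alpha> n)"
  by (simp add: seq_mult_x_def fun_eq_iff)

lemma seq_shift_cmult: "seq_shift (\<lambda>n. c * \<alpha> n) = (\<lambda>n. c * seq_shift \<alpha> n)"
  by (simp add: seq_shift_def fun_eq_iff)

lemma seq_shift_mult_x3:
  "seq_shift (seq_mult_x (seq_mult_x (seq_mult_x \<alpha>))) =
     (\<lambda>n. seq_mult_x (seq_mult_x (seq_mult_x (seq_shift \<alpha>))) n + 3 * seq_mult_x (seq_mult_x \<alpha>) n)"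
  by (simp add: seq_shift_mult_x seq_mult_x_add seq_mult_x_cmult fun_eq_iff)

lemma seq_shift_mult_x2:
  "seq_shift (seq_mult_x (seq_mult_x \<alpha>)) =
     (\<lambda>n. seq_mult_x (seq_mult_x (seq_shift \<alpha>)) n + 2 * seq_mult_x \<alpha> n)"
  by (simp add: seq_shift_mult_x seq_mult_x_add seq_mult_x_cmult fun_eq_iff)

text \<open>
  The heat transform turns \<open>\<phi>'''' = - \<rho> x^3 \<phi>\<close> into \<open>v_xxxx = - \<rho> (x + t \<partial>_x)^3 v\<close>. Together
  with two \<open>x\<close>-derivatives of this equation, every derivative of \<open>v\<close> that is needed reduces to
  the first four.
\<close>

lemma heat_subst_stationary:
  fixes F :: "real fps" and \<alpha>
  assumes "F $ 0 = 0"
    and rec: "\<And>n. \<alpha> (n + 4) = - \<rho> * seq_mult_x (seq_mult_x (seq_mult_x \<alpha>)) n"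
  defines "W \<equiv> \<lambda>i. heat_subst F ((seq_shift ^^ i) \<alpha>)"
  shows "W 4 = - fps_const \<rho> * ((F^3 + 3*F*fps_X) * W 0 + (3*F^2*fps_X + 3*fps_X^2) * W 1
                 + 3*F*fps_X^2 * W 2 + fps_X^3 * W 3)"
    and "W 5 = - fps_const \<rho> * ((F^3 + 3*F*fps_X) * W 1 + (3*F^2*fps_X + 3*fps_X^2) * W 2
                 + 3*F*fps_X^2 * W 3 + fps_X^3 * W 4
                 + 3 * ((F^2 + fps_X) * W 0 + 2*F*fps_X * W 1 + fps_X^2 * W 2))"
    and "W 6 = - fps_const \<rho> * ((F^3 + 3*F*fps_X) * W 2 + (3*F^2*fps_X + 3*fps_X^2) * W 3
                 + 3*F*fps_X^2 * W 4 + fps_X^3 * W 5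
                 + 6 * ((F^2 + fps_X) * W 1 + 2*F*fps_X * W 2 + fps_X^2 * W 3)
                 + 6 * (F * W 0 + fps_X * W 1))"
proof -
  have shift4: "(seq_shift ^^ 4) \<alpha> = (\<lambda>n. - \<rho> * seq_mult_x (seq_mult_x (seq_mult_x \<alpha>)) n)"
    using rec by (simp add: fun_eq_iff numeral_eq_Suc seq_shift_def)
  have shift5: "(seq_shift ^^ 5) \<alpha> = (\<lambda>n. - \<rho> * (seq_mult_x (seq_mult_x (seq_mult_x (seq_shift \<alpha>))) n
       + 3 * seq_mult_x (seq_mult_x \<alpha>) n))"
  proof -
    have "(seq_shift ^^ 5) \<alpha> = seq_shift ((seq_shift ^^ 4) \<alpha>)" by (simp add: numeral_eq_Suc)
    thus ?thesis unfolding shift4 seq_shift_cmult seq_shift_mult_x3 .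
  qed
  have shift6: "(seq_shift ^^ 6) \<alpha> = (\<lambda>n. - \<rho> * (seq_mult_x (seq_mult_x (seq_mult_x (seq_shift (seq_shift \<alpha>)))) n
       + 6 * seq_mult_x (seq_mult_x (seq_shift \<alpha>)) n + 6 * seq_mult_x \<alpha> n))"
  proof -
    have "(seq_shift ^^ 6) \<alpha> = seq_shift ((seq_shift ^^ 5) \<alpha>)" by (simp add: numeral_eq_Suc)
    also have "\<dots> = (\<lambda>n. - \<rho> * (seq_mult_x (seq_mult_x (seq_mult_x (seq_shift (seq_shift \<alpha>)))) n
       + 3 * seq_mult_x (seq_mult_x (seq_shift \<alpha>)) n
       + 3 * (seq_mult_x (seq_mult_x (seq_shift \<alpha>)) n + 2 * seq_mult_x \<alpha> n)))"
      unfolding shift5 seq_shift_cmult seq_shift_add seq_shift_mult_x3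
      unfolding seq_shift_mult_x2 ..
    finally show ?thesis by (simp add: algebra_simps)
  qed
  have W: "heat_subst F \<alpha> = W 0" "heat_subst F (seq_shift \<alpha>) = W 1"
     "heat_subst F (seq_shift (seq_shift \<alpha>)) = W 2"
     "heat_subst F (seq_shift (seq_shift (seq_shift \<alpha>))) = W 3"
     "heat_subst F (seq_shift (seq_shift (seq_shift (seq_shift \<alpha>)))) = W 4"
     "heat_subst F (seq_shift (seq_shift (seq_shift (seq_shift (seq_shift \<alpha>))))) = W 5"
    by (simp_all add: W_def numeral_eq_Suc)
  have neg: "fps_const (- \<rho>) = - fps_const \<rho>" by simp
  note linear = heat_subst_cmult heat_subst_add neg numeral_fps_const[symmetric]
  note mult = heat_subst_mult_x3[OF assms(1)] heat_subst_mult_x2[OF assms(1)] heat_subst_mult_x[OF assms(1)]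
  have "W 4 = heat_subst F ((seq_shift ^^ 4) \<alpha>)" by (simp add: W_def)
  thus "W 4 = - fps_const \<rho> * ((F^3 + 3*F*fps_X) * W 0 + (3*F^2*fps_X + 3*fps_X^2) * W 1
                 + 3*F*fps_X^2 * W 2 + fps_X^3 * W 3)"
    unfolding shift4 linear mult(1)
    unfolding mult(2)
    unfolding mult(3) W .
  have "W 5 = heat_subst F ((seq_shift ^^ 5) \<alpha>)" by (simp add: W_def)
  thus "W 5 = - fps_const \<rho> * ((F^3 + 3*F*fps_X) * W 1 + (3*F^2*fps_X + 3*fps_X^2) * W 2
                 + 3*F*fps_X^2 * W 3 + fps_X^3 * W 4
                 + 3 * ((F^2 + fps_X) * W 0 + 2*F*fps_X * W 1 + fps_X^2 * W 2))"
    unfolding shift5 linear mult(1)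
    unfolding mult(2)
    unfolding mult(3) W .
  have "W 6 = heat_subst F ((seq_shift ^^ 6) \<alpha>)" by (simp add: W_def)
  thus "W 6 = - fps_const \<rho> * ((F^3 + 3*F*fps_X) * W 2 + (3*F^2*fps_X + 3*fps_X^2) * W 3
                 + 3*F*fps_X^2 * W 4 + fps_X^3 * W 5
                 + 6 * ((F^2 + fps_X) * W 1 + 2*F*fps_X * W 2 + fps_X^2 * W 3)
                 + 6 * (F * W 0 + fps_X * W 1))"
    unfolding shift6 linear mult(1)
    unfolding mult(2)
    unfolding mult(3) W .
qed

definition fps_theta :: "real fps \<Rightarrow> real fps" where
  "fps_theta P = fps_X * fps_deriv P"

definition fps_opA :: "real fps \<Rightarrow> real fps" where
  "fps_opA P = 4 * P + 7 * fps_theta P"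

definition fps_opB :: "real fps \<Rightarrow> real fps" where
  "fps_opB P = 3 * fps_opA P + 7 * fps_theta (fps_opA P)"

definition fps_opC :: "real fps \<Rightarrow> real fps" where
  "fps_opC P = 2 * fps_opB P + 7 * fps_theta (fps_opB P)"

definition fps_det :: "real fps \<Rightarrow> real fps" where
  "fps_det P = det_poly fps_X P (fps_opA P) (fps_opB P) (fps_opC P)"

definition fps_branch :: "real \<Rightarrow> real fps \<Rightarrow> real fps" where
  "fps_branch \<rho> P =
     fps_const (\<rho> / 16) * fps_X ^ 4 * (P oo (fps_const (\<rho>\<^sup>2 / 128) * fps_X ^ 7))"

lemma fps_compose_monomial_nth:
  fixes P :: "'a :: idom fps"
  assumes "m > 0"
  shows "(P oo (fps_const c * fps_X ^ m)) $ n =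
     (if m dvd n then P $ (n div m) * c ^ (n div m) else 0)"
proof -
  have pow: "((fps_const c * fps_X ^ m) ^ i) $ n = (if n = m * i then c ^ i else 0)" for i
    by (simp add: power_mult_distrib fps_const_power flip: power_mult)
  have "(P oo (fps_const c * fps_X ^ m)) $ n =
      (\<Sum>i\<in>{0..n}. if i = n div m \<and> m dvd n then P $ i * c ^ i else 0)"
    unfolding fps_compose_nth pow using assms by (intro sum.cong) auto
  also have "\<dots> = (if m dvd n then P $ (n div m) * c ^ (n div m) else 0)"
    by (simp add: sum.delta)
  finally show ?thesis .
qed

section \<open>Substituting \<open>z = c t^7\<close> turns \<open>7 \<theta>\<close> into \<open>t d/dt\<close>. This is why \<open>A\<close>, \<open>B\<close>, \<open>C\<close> describe the
  first three derivatives of the branch.\<close>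

lemma fps_theta_compose:
  fixes P :: "real fps" and c :: real
  defines "Z \<equiv> fps_const c * fps_X ^ 7"
  shows "7 * (fps_theta P oo Z) = fps_X * fps_deriv (P oo Z)"
proof -
  have Z0: "Z $ 0 = 0" by (simp add: Z_def)
  have "fps_X * fps_deriv Z = 7 * Z"
    by (rule fps_ext) (simp add: Z_def fps_X_power_nth numeral_fps_const)
  hence "fps_X * fps_deriv (P oo Z) = 7 * Z * (fps_deriv P oo Z)"
    by (simp add: fps_compose_deriv[OF Z0] mult_ac)
  thus ?thesis
    by (simp add: fps_theta_def fps_compose_mult_distrib[OF Z0] Z0)
qed

text \<open>
  On a determinant branch the elimination leaves a third order linear equation for
  \<open>W = v(t, F(t))\<close> alone. Its indicial polynomial is a multiple of
  \<open>n (n - 1) (\<Phi>'(0) (n - 17) + 1)\<close>. If no root of it occurs as an exponent in \<open>W\<close>, then \<open>W = 0\<close>.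
\<close>

lemma fps_branch_heat_zero:
  fixes P :: "real fps"
  assumes "\<rho> \<noteq> 0" and P0: "P $ 0 = 1" and det: "fps_det P = 0"
    and rec: "\<And>n. \<alpha> (n + 4) = - \<rho> * seq_mult_x (seq_mult_x (seq_mult_x \<alpha>)) n"
    and indicial: "\<And>n. heat_subst (fps_branch \<rho> P) \<alpha> $ n \<noteq> 0 \<Longrightarrow>
        n \<noteq> 0 \<and> n \<noteq> 1 \<and> P $ 1 * (real n - 17) + 1 \<noteq> 0"
  shows "heat_subst (fps_branch \<rho> P) \<alpha> = 0"
proof -
  define \<kappa> where "\<kappa> = \<rho> / 16"
  define s where "s = 2 * \<kappa>\<^sup>2"
  define k where "k = fps_const \<kappa>"
  define Z where "Z = fps_const s * fps_X ^ 7"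
  define p where "p = P oo Z"
  define a where "a = fps_opA P oo Z"
  define b where "b = fps_opB P oo Z"
  define c where "c = fps_opC P oo Z"
  define F where "F = fps_branch \<rho> P"
  have s: "s = \<rho>\<^sup>2 / 128" "s \<noteq> 0"
    using \<open>\<rho> \<noteq> 0\<close> by (auto simp: s_def \<kappa>_def power2_eq_square)
  have Z0 [simp]: "Z $ 0 = 0" by (simp add: Z_def)
  have F: "F = k * fps_X ^ 4 * p"
    by (simp add: F_def fps_branch_def k_def p_def Z_def s \<kappa>_def)
  have F0: "F $ 0 = 0" by (simp add: F)
  have Zk: "2 * k ^ 2 * fps_X ^ 7 = Z"
    by (simp add: Z_def k_def s_def numeral_fps_const fps_const_power flip: fps_const_mult)
  have \<rho>k: "fps_const \<rho> = 16 * k"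
    by (simp add: k_def \<kappa>_def numeral_fps_const)
  have det': "det_poly Z p a b c = 0"
  proof -
    have "fps_det P oo Z = det_poly Z p a b c"
      unfolding fps_det_def det_poly_def p_def a_def b_def c_def
      by (simp add: fps_compose_add_distrib fps_compose_sub_distrib fps_compose_mult_distrib
            fps_compose_power[symmetric] fps_compose_uminus)
    thus ?thesis by (simp add: det)
  qed
  have a: "a = 4 * p + fps_X * fps_deriv p"
    using fps_theta_compose[of P s]
    by (simp add: a_def fps_opA_def fps_compose_add_distrib fps_compose_mult_distrib p_def flip: Z_def)
  have b: "b = 3 * a + fps_X * fps_deriv a"
    using fps_theta_compose[of "fps_opA P" s]
    by (simp add: b_def fps_opB_def fps_compose_add_distrib fps_compose_mult_distrib a_def flip: Z_def)
  have c: "c = 2 * b + fps_X * fps_deriv b"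
    using fps_theta_compose[of "fps_opB P" s]
    by (simp add: c_def fps_opC_def fps_compose_add_distrib fps_compose_mult_distrib b_def flip: Z_def)
  have dmon: "fps_deriv (k * fps_X ^ Suc m * G) =
      k * fps_X ^ m * (of_nat (Suc m) * G + fps_X * fps_deriv G)" for m G
  proof -
    have "fps_deriv (fps_X ^ Suc m * G) = fps_X ^ m * (of_nat (Suc m) * G + fps_X * fps_deriv G)"
      unfolding fps_deriv_mult fps_deriv_power fps_of_nat by (simp add: algebra_simps)
    thus ?thesis by (simp add: k_def mult.assoc del: power_Suc)
  qed
  have F1: "fps_deriv F = k * fps_X ^ 3 * a"
    using dmon[of 3 p] by (simp add: F a numeral_eq_Suc del: power_Suc)
  have F2: "fps_deriv (fps_deriv F) = k * fps_X ^ 2 * b"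
    using dmon[of 2 a] by (simp add: F1 b numeral_eq_Suc del: power_Suc)
  have F3: "fps_deriv (fps_deriv (fps_deriv F)) = k * fps_X * c"
    using dmon[of 1 b] by (simp add: F2 c numeral_eq_Suc)

  define W where "W = (\<lambda>i. heat_subst F ((seq_shift ^^ i) \<alpha>))"
  note derivs = heat_subst_derivs[OF F0, of \<alpha>, folded W_def]
  note stat = heat_subst_stationary[where F = F and \<alpha> = \<alpha> and \<rho> = \<rho>, OF F0 rec, folded W_def,
      unfolded \<rho>k]
  have "fps_X^3 * (a - 4) * (8 * fps_deriv (fps_deriv (fps_deriv (W 0))))
      + fps_X^2 * elim2 Z p a b * (4 * fps_deriv (fps_deriv (W 0)))
      + fps_X * elim1 Z p a b * (2 * fps_deriv (W 0)) + elim0 Z p a b * W 0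
      = - 4 * k * fps_X^4 * det_poly Z p a b c * W 1"
    using boundary_elimination[OF F F1 F2 F3 stat derivs]
    unfolding Zk W_def .
  hence eq: "8 * (a - 4) * (fps_X ^ 3 * fps_deriv (fps_deriv (fps_deriv (W 0))))
      + 4 * elim2 Z p a b * (fps_X ^ 2 * fps_deriv (fps_deriv (W 0)))
      + 2 * elim1 Z p a b * (fps_X * fps_deriv (W 0)) + elim0 Z p a b * W 0 = 0"
    unfolding det' by (simp only: mult_ac mult_zero_left mult_zero_right)

  \<comment> \<open>Since \<open>A(0) = 4\<close> and \<open>B(0) = 12\<close>, all coefficients of the equation vanish to order \<open>t^7\<close>; at
    \<open>t^7\<close> only the linear coefficients of \<open>A\<close> and \<open>B\<close> and the constant terms behind a factor \<open>z\<close>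
    matter.\<close>
  have comp: "(Q oo Z) $ n = (if 7 dvd n then Q $ (n div 7) * s ^ (n div 7) else 0)" for Q n
    unfolding Z_def by (rule fps_compose_monomial_nth) simp
  have low: "(Q oo Z) $ i = (if i = 0 then Q $ 0 else 0)" if "i < 7" for Q i
    using that by (auto simp: comp dvd_imp_le)
  have mid: "(Q oo Z) $ 7 = s * Q $ 1" for Q
    by (simp add: comp)
  have ZQ_low: "(Z * Q) $ i = 0" if "i < 7" for Q i
    using that by (simp add: Z_def mult.assoc fps_X_power_mult_nth)
  have ZQ_mid: "(Z * Q) $ 7 = s * Q $ 0" for Q
    by (simp add: Z_def mult.assoc fps_X_power_mult_nth)
  have A0: "fps_opA P $ 0 = 4" and A1: "fps_opA P $ 1 = 11 * P $ 1"
    and B0: "fps_opB P $ 0 = 12" and B1: "fps_opB P $ 1 = 110 * P $ 1"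
    by (simp_all add: fps_opA_def fps_opB_def fps_theta_def P0 fps_numeral_nth)
  have p0: "p $ 0 = 1" and a0: "a $ 0 = 4" and b0: "b $ 0 = 12"
    by (simp_all add: p_def a_def b_def P0 A0 B0)

  have "W 0 = 0"
  proof (rule euler_equation_zero[OF eq, of 7])
    show "(8 * (a - 4)) $ i = 0" if "i < 7" for i
      using low[OF that, of "fps_opA P"] A0 by (simp add: a_def fps_numeral_nth)
    show "(4 * elim2 Z p a b) $ i = 0" if "i < 7" for i
      using low[OF that, of "fps_opB P"] B0 ZQ_low[OF that]
      by (simp add: elim2_def b_def fps_numeral_nth)
    show "(2 * elim1 Z p a b) $ i = 0" if "i < 7" for i
      using ZQ_low[OF that] by (simp add: elim1_def)
    show "elim0 Z p a b $ i = 0" if "i < 7" for i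
      using ZQ_low[OF that] by (simp add: elim0_def)
    fix n assume "W 0 $ n \<noteq> 0"
    hence n: "n \<noteq> 0" "n \<noteq> 1" "P $ 1 * (real n - 17) + 1 \<noteq> 0"
      using indicial by (auto simp: W_def F_def)
    have c3: "(8 * (a - 4)) $ 7 = 88 * s * P $ 1"
      using mid[of "fps_opA P"] A1 by (simp add: a_def fps_numeral_nth)
    have c2: "(4 * elim2 Z p a b) $ 7 = 88 * s - 1320 * (s * P $ 1)"
      using mid[of "fps_opB P"] B1
      by (simp add: elim2_def b_def[symmetric] ZQ_mid p0 a0 b0 fps_numeral_nth fps_nth_power_0)
    have c1: "(2 * elim1 Z p a b) $ 7 = 0"
      by (simp add: elim1_def ZQ_mid p0 a0 b0 fps_nth_power_0)
    have c0: "elim0 Z p a b $ 7 = 0"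
      by (simp add: elim0_def ZQ_mid p0 a0 b0 fps_nth_power_0)
    have "(8 * (a - 4)) $ 7 * (real n * (real n - 1) * (real n - 2))
        + (4 * elim2 Z p a b) $ 7 * (real n * (real n - 1))
        + (2 * elim1 Z p a b) $ 7 * real n + elim0 Z p a b $ 7
        = 88 * s * (real n * (real n - 1)) * (P $ 1 * (real n - 17) + 1)"
      unfolding c3 c2 c1 c0 by (simp add: algebra_simps)
    also have "\<dots> \<noteq> 0" using n s by auto
    finally show "(8 * (a - 4)) $ 7 * (real n * (real n - 1) * (real n - 2))
        + (4 * elim2 Z p a b) $ 7 * (real n * (real n - 1))
        + (2 * elim1 Z p a b) $ 7 * real n + elim0 Z p a b $ 7 \<noteq> 0" .
  qed
  thus ?thesis by (simp add: W_def F_def)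
qed

definition fps_supported :: "nat \<Rightarrow> real fps \<Rightarrow> bool" where
  "fps_supported q F \<longleftrightarrow> (\<forall>n. F $ n \<noteq> 0 \<longrightarrow> n mod 7 = q mod 7)"

lemma fps_supported_mult:
  assumes "fps_supported p F" "fps_supported q G"
  shows "fps_supported (p + q) (F * G)"
  unfolding fps_supported_def
proof (intro allI impI)
  fix n assume "(F * G) $ n \<noteq> 0"
  then obtain i where "i \<le> n" "F $ i \<noteq> 0" "G $ (n - i) \<noteq> 0"
    unfolding fps_mult_nth by (metis (no_types, lifting) atLeastAtMost_iff mult_eq_0_iff sum.neutral)
  hence "i mod 7 = p mod 7" "(n - i) mod 7 = q mod 7"
    using assms by (auto simp: fps_supported_def)
  hence "(i + (n - i)) mod 7 = (p + q) mod 7" by (rule mod_add_cong)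
  thus "n mod 7 = (p + q) mod 7" using \<open>i \<le> n\<close> by simp
qed

lemma fps_supported_power:
  assumes "fps_supported p F"
  shows "fps_supported (p * j) (F ^ j)"
proof (induction j)
  case 0
  show ?case by (simp add: fps_supported_def fps_one_nth)
next
  case (Suc j)
  show ?case using fps_supported_mult[OF assms Suc] by simp
qed

lemma fps_branch_supported: "fps_supported 4 (fps_branch \<rho> P)"
proof -
  have "fps_supported 0 (fps_const (\<rho> / 16))"
    by (simp add: fps_supported_def)
  moreover have "fps_supported 4 (fps_X ^ 4)"
    by (simp add: fps_supported_def fps_X_power_nth)
  moreover have "fps_supported 0 (P oo (fps_const (\<rho>\<^sup>2 / 128) * fps_X ^ 7))"
    by (auto simp: fps_supported_def fps_compose_monomial_nth)
  ultimately show ?thesis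
    unfolding fps_branch_def
    using fps_supported_mult[OF fps_supported_mult] by force
qed

section \<open>With \<open>t\<close> of weight 1 and \<open>x = F(t)\<close> of weight 4, the monomial \<open>t^k x^j\<close> has weight
  \<open>k + 4 j\<close>, which is congruent to \<open>4 (j + 2 k)\<close> modulo 7.\<close>

lemma heat_subst_supported:
  assumes "fps_supported 4 F" and "\<And>n. \<alpha> n \<noteq> 0 \<Longrightarrow> n mod 7 = r"
  shows "fps_supported (4 * r) (heat_subst F \<alpha>)"
  unfolding fps_supported_def
proof (intro allI impI)
  fix n assume "heat_subst F \<alpha> $ n \<noteq> 0"
  then obtain k j where kj: "heat_coeff \<alpha> k j * (fps_X ^ k * F ^ j) $ n \<noteq> 0"
    unfolding heat_subst_def fps_nth_Abs_fps heat_partial_nth by (meson sum.neutral)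
  have "fps_supported (k + 4 * j) (fps_X ^ k * F ^ j)"
    by (intro fps_supported_mult fps_supported_power assms) (simp add: fps_supported_def fps_X_power_nth)
  hence "n mod 7 = (k + 4 * j) mod 7"
    using kj by (simp add: fps_supported_def)
  moreover have "(j + 2 * k) mod 7 = r"
    using kj assms(2) by (auto simp: heat_coeff_def)
  moreover have "(k + 4 * j) mod 7 = (4 * (j + 2 * k)) mod 7"
  proof -
    have "4 * (j + 2 * k) = k + 4 * j + 7 * k" by simp
    thus ?thesis by (simp only: mod_mult_self2)
  qed
  ultimately show "n mod 7 = (4 * r) mod 7"
    by (metis mod_mult_right_eq)
qed

section \<open>Uniqueness of the zero curve\<close>

lemma fps_X_power_dvd_nth:
  fixes f :: "'a :: comm_ring_1 fps"
  assumes "fps_X ^ m dvd f" "i < m"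
  shows "f $ i = 0"
  using assms by (auto simp: fps_X_power_mult_nth elim!: dvdE)

lemma fps_X_power_dvdI:
  fixes f :: "'a :: comm_ring_1 fps"
  assumes "\<And>i. i < m \<Longrightarrow> f $ i = 0"
  shows "fps_X ^ m dvd f"
proof
  show "f = fps_X ^ m * fps_shift m f"
    by (rule fps_ext) (use assms in \<open>auto simp: fps_X_power_mult_nth\<close>)
qed

text \<open>
  Let \<open>D = F - G \<noteq> 0\<close> start in degree \<open>d\<close>. In \<open>v(t, F) - v(t, G)\<close> the powers \<open>x^j\<close> with
  \<open>j \<ge> 2\<close> contribute \<open>D\<close> times a series divisible by \<open>t^2\<close>, as both curves are \<open>O(t^2)\<close>. So up to
  degree \<open>d + 1\<close> only the linear term \<open>v_x(t, 0) D\<close> is visible, and \<open>v_x(t, 0)\<close> is not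
  \<open>O(t^2)\<close> by the last hypothesis.
\<close>

lemma heat_subst_inj:
  assumes F: "fps_X ^ 2 dvd F" and G: "fps_X ^ 2 dvd G"
    and eq: "heat_subst F \<alpha> = heat_subst G \<alpha>"
    and nondeg: "heat_coeff \<alpha> 0 1 \<noteq> 0 \<or> heat_coeff \<alpha> 1 1 \<noteq> 0"
  shows "F = G"
proof (rule ccontr)
  assume "F \<noteq> G"
  define D where "D = F - G"
  define d where "d = subdegree D"
  have "D \<noteq> 0" using \<open>F \<noteq> G\<close> by (simp add: D_def)
  hence D: "D $ d \<noteq> 0" unfolding d_def by (rule nth_subdegree_nonzero)
  have Dd: "fps_X ^ d dvd D"
    by (rule fps_X_power_dvdI) (use nth_less_subdegree_zero in \<open>auto simp: d_def\<close>)
  have F0: "F $ 0 = 0" "G $ 0 = 0" using F G by (auto intro!: fps_X_power_dvd_nth)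
  have high: "fps_X ^ (d + 2) dvd F ^ j - G ^ j" if "j \<ge> 2" for j
  proof -
    define i where "i = j - 1"
    have j: "j = Suc i" and "i \<ge> 1" using that by (simp_all add: i_def)
    have "fps_X ^ 2 dvd F ^ m * G ^ (i - m)" if "m \<le> i" for m
    proof (cases "m = 0")
      case True
      thus ?thesis using G \<open>i \<ge> 1\<close> by (simp add: dvd_power_le dvd_trans[OF G dvd_power])
    next
      case False
      thus ?thesis using F by (simp add: dvd_mult2 dvd_trans[OF F dvd_power])
    qed
    hence "fps_X ^ 2 dvd (\<Sum>m<Suc i. F ^ m * G ^ (i - m))"
      by (intro dvd_sum) auto
    moreover have "F ^ j - G ^ j = D * (\<Sum>m<Suc i. F ^ m * G ^ (i - m))"
      unfolding j D_def by (rule diff_power_eq_sum)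
    ultimately show ?thesis using Dd by (simp only: power_add mult_dvd_mono)
  qed
  have coeff: "heat_coeff \<alpha> 0 1 * D $ n + heat_coeff \<alpha> 1 1 * (fps_X * D) $ n = 0" if n: "n < d + 2" for n
  proof -
    define g where "g = (\<lambda>(k, j). heat_coeff \<alpha> k j * (fps_X ^ k * (F ^ j - G ^ j)) $ n)"
    have "0 = heat_partial (n + 1) (n + 1) F \<alpha> $ n - heat_partial (n + 1) (n + 1) G \<alpha> $ n"
      using eq heat_subst_nth[of F n "n + 1" "n + 1" \<alpha>]
        heat_subst_nth[of G n "n + 1" "n + 1" \<alpha>] F0 by simp
    also have "\<dots> = (\<Sum>z\<in>{..n + 1} \<times> {..n + 1}. g z)"
      unfolding heat_partial_nth sum.cartesian_product g_def
      by (simp only: sum_subtractf[symmetric]) (intro sum.cong, auto simp: algebra_simps)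
    also have "\<dots> = (\<Sum>z\<in>{(0, 1), (1, 1)}. g z)"
    proof (rule sum.mono_neutral_right)
      show "\<forall>z\<in>{..n + 1} \<times> {..n + 1} - {(0, 1), (1, 1)}. g z = 0"
      proof
        fix z assume z: "z \<in> {..n + 1} \<times> {..n + 1} - {(0, 1), (1, 1)}"
        obtain k j where kj: "z = (k, j)" by force
        have "(fps_X ^ k * (F ^ j - G ^ j)) $ n = 0"
        proof -
          consider "j = 0" | "j = 1" "k \<ge> 2" | "j \<ge> 2" using z kj by fastforce
          thus ?thesis
          proof cases
            case 2
            have "fps_X ^ (2 + d) dvd fps_X ^ k * D"
              unfolding power_add using 2 Dd by (intro mult_dvd_mono le_imp_power_dvd)
            thus ?thesis using 2 n by (auto simp: D_def intro!: fps_X_power_dvd_nth)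
          next
            case 3
            thus ?thesis using high[OF 3] n by (intro fps_X_power_dvd_nth[of "d + 2"] dvd_mult) auto
          qed simp
        qed
        thus "g z = 0" by (simp add: g_def kj)
      qed
    qed auto
    also have "\<dots> = heat_coeff \<alpha> 0 1 * D $ n + heat_coeff \<alpha> 1 1 * (fps_X * D) $ n"
      by (simp add: g_def D_def)
    finally show ?thesis by simp
  qed
  show False
  proof (cases "heat_coeff \<alpha> 0 1 = 0")
    case False
    have "(fps_X * D) $ d = 0"
      using Dd by (intro fps_X_power_dvd_nth[of "Suc d"]) (auto intro: mult_dvd_mono)
    with coeff[of d] False D show False by simp
  next
    case True
    with coeff[of "Suc d"] nondeg D show False by simp
  qed
qed

section \<open>From power series to germs\<close>

text \<open>
  Splitting off \<open>t^n\<close> with a factor that has a limit at 0. This yields both the order estimate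
  for the branch and the identity theorem for real germs.
\<close>

lemma has_fps_expansion_leading:
  fixes f :: "real \<Rightarrow> real"
  assumes "f has_fps_expansion F" "\<And>i. i < n \<Longrightarrow> F $ i = 0"
  obtains h where "(h \<longlongrightarrow> F $ n) (nhds 0)" "\<forall>\<^sub>F t in nhds 0. f t = t ^ n * h t"
proof -
  define H where "H = fps_shift n F"
  have F: "F = fps_X ^ n * H"
    by (rule fps_ext) (use assms(2) in \<open>auto simp: H_def fps_X_power_mult_nth\<close>)
  have radius: "fps_conv_radius H > 0"
    using assms(1) by (simp add: H_def has_fps_expansion_def)
  have "isCont (eval_fps H) 0"
    using radius by (intro continuous_eval_fps) (simp add: zero_ereal_def)
  hence "(eval_fps H \<longlongrightarrow> F $ n) (nhds 0)"
    by (simp add: isCont_def tendsto_nhds_iff eval_fps_at_0 H_def)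
  moreover have "\<forall>\<^sub>F t in nhds 0. t \<in> eball 0 (fps_conv_radius H)"
    using radius by (intro eventually_nhds_in_open) (auto simp: zero_ereal_def)
  hence "\<forall>\<^sub>F t in nhds 0. f t = t ^ n * eval_fps H t"
    using assms(1)[unfolded has_fps_expansion_def, THEN conjunct2]
    by eventually_elim (simp add: F eval_fps_mult)
  ultimately show thesis by (rule that)
qed

lemma has_fps_expansion_bigo:
  fixes f :: "real \<Rightarrow> real"
  assumes "f has_fps_expansion F" "\<And>i. i < n \<Longrightarrow> F $ i = 0"
  shows "f \<in> O[nhds 0](\<lambda>t. t ^ n)"
proof -
  obtain h where h: "(h \<longlongrightarrow> F $ n) (nhds 0)" "\<forall>\<^sub>F t in nhds 0. f t = t ^ n * h t"
    using has_fps_expansion_leading[OF assms] by blast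
  have "((\<lambda>t. \<bar>h t\<bar>) \<longlongrightarrow> \<bar>F $ n\<bar>) (nhds 0)" by (intro tendsto_intros h)
  hence "\<forall>\<^sub>F t in nhds 0. \<bar>h t\<bar> < \<bar>F $ n\<bar> + 1" by (rule order_tendstoD) simp
  with h(2) have "\<forall>\<^sub>F t in nhds 0. norm (f t) \<le> (\<bar>F $ n\<bar> + 1) * norm (t ^ n)"
  proof eventually_elim
    case (elim t)
    have "\<bar>t ^ n\<bar> * \<bar>h t\<bar> \<le> \<bar>t ^ n\<bar> * (\<bar>F $ n\<bar> + 1)"
      using elim(2) by (intro mult_left_mono) auto
    thus ?case by (simp add: elim(1) abs_mult mult.commute)
  qed
  thus ?thesis by (rule bigoI)
qed

lemma has_fps_expansion_eventually_zero:
  fixes f :: "real \<Rightarrow> real"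
  assumes "f has_fps_expansion F" "\<forall>\<^sub>F t in nhds 0. f t = 0"
  shows "F = 0"
proof (rule ccontr)
  assume "F \<noteq> 0"
  define n where "n = subdegree F"
  have n: "F $ n \<noteq> 0" unfolding n_def using \<open>F \<noteq> 0\<close> by (rule nth_subdegree_nonzero)
  obtain h where h: "(h \<longlongrightarrow> F $ n) (nhds 0)" "\<forall>\<^sub>F t in nhds 0. f t = t ^ n * h t"
    using has_fps_expansion_leading[OF assms(1), of n] nth_less_subdegree_zero
    unfolding n_def by blast
  have "\<forall>\<^sub>F t in nhds 0. h t \<noteq> 0"
    using tendsto_imp_eventually_ne[OF h(1) n] .
  with h(2) assms(2) have "\<forall>\<^sub>F t in nhds 0. (t :: real) ^ n = 0"
    by eventually_elim auto
  hence "\<forall>\<^sub>F t in at 0. (t :: real) ^ n = 0"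
    unfolding eventually_nhds_conv_at by blast
  moreover have "\<forall>\<^sub>F t in at 0. (t :: real) \<noteq> 0"
    by (rule eventually_neq_at_within)
  ultimately have "\<forall>\<^sub>F t in at (0 :: real). False"
    by eventually_elim auto
  thus False by simp
qed

lemma has_fps_expansion_compose_monomial:
  fixes f :: "real \<Rightarrow> real"
  assumes f: "f has_fps_expansion F" and "m > 0"
  shows "(\<lambda>t. f (c * t ^ m)) has_fps_expansion (F oo (fps_const c * fps_X ^ m))"
proof (rule has_fps_expansionI)
  have "\<forall>\<^sub>F z in nhds 0. z \<in> eball 0 (fps_conv_radius F)"
    using f by (intro eventually_nhds_in_open) (auto simp: has_fps_expansion_def zero_ereal_def)
  moreover have "\<forall>\<^sub>F z in nhds 0. eval_fps F z = f z"
    using f by (simp add: has_fps_expansion_def)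
  ultimately have "\<forall>\<^sub>F z in nhds 0. (\<lambda>n. F $ n * z ^ n) sums f z"
  proof eventually_elim
    case (elim z)
    thus ?case using sums_eval_fps[of z F] by simp
  qed
  moreover have "filterlim (\<lambda>t. c * t ^ m) (nhds 0) (nhds (0 :: real))"
  proof -
    have "((\<lambda>t. c * t ^ m) \<longlongrightarrow> c * 0 ^ m) (nhds (0 :: real))"
      by (intro tendsto_intros filterlim_ident)
    thus ?thesis using \<open>m > 0\<close> by (simp add: zero_power)
  qed
  ultimately have "\<forall>\<^sub>F t in nhds 0. (\<lambda>n. F $ n * (c * t ^ m) ^ n) sums f (c * t ^ m)"
    by (rule eventually_compose_filterlim)
  thus "\<forall>\<^sub>F t in nhds 0. (\<lambda>n. (F oo (fps_const c * fps_X ^ m)) $ n * t ^ n) sums f (c * t ^ m)"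
  proof eventually_elim
    case (elim t)
    have "(\<lambda>n. (F oo (fps_const c * fps_X ^ m)) $ (m * n) * t ^ (m * n)) sums f (c * t ^ m)"
      using elim \<open>m > 0\<close> by (simp add: fps_compose_monomial_nth power_mult_distrib power_mult mult.assoc)
    moreover have "strict_mono (\<lambda>n. m * n)"
      using \<open>m > 0\<close> by (auto intro!: strict_monoI)
    ultimately show ?case
      by (subst (asm) sums_mono_reindex)
         (auto simp: fps_compose_monomial_nth[OF \<open>m > 0\<close>] dvd_def)
  qed
qed

lemma fps_op_has_fps_expansion:
  assumes "\<Phi> has_fps_expansion P"
  shows "opA \<Phi> has_fps_expansion fps_opA P"
    and "opB \<Phi> has_fps_expansion fps_opB P"
    and "opC \<Phi> has_fps_expansion fps_opC P"
proof -
  have theta: "theta f has_fps_expansion fps_theta F" if "f has_fps_expansion F" for f F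
    unfolding theta_def fps_theta_def by (intro fps_expansion_intros that)
  show A: "opA \<Phi> has_fps_expansion fps_opA P"
    unfolding opA_def fps_opA_def by (intro fps_expansion_intros theta assms)
  show B: "opB \<Phi> has_fps_expansion fps_opB P"
    unfolding opB_def fps_opB_def by (intro fps_expansion_intros theta A)
  show "opC \<Phi> has_fps_expansion fps_opC P"
    unfolding opC_def fps_opC_def by (intro fps_expansion_intros theta B)
qed

lemma det_solution_fps:
  assumes "det_solution \<Phi>"
  obtains P where "\<Phi> has_fps_expansion P" "P $ 0 = 1" "P $ 1 = deriv \<Phi> 0" "fps_det P = 0"
proof -
  obtain P where P: "\<Phi> has_fps_expansion P"
    using assms by (auto simp: det_solution_def analytic_germ_def)
  have "(\<lambda>z. det_poly z (\<Phi> z) (opA \<Phi> z) (opB \<Phi> z) (opC \<Phi> z)) has_fps_expansion fps_det P"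
    unfolding det_poly_def fps_det_def
    by (intro fps_expansion_intros fps_op_has_fps_expansion P)
  moreover have "\<forall>\<^sub>F z in nhds 0. det_poly z (\<Phi> z) (opA \<Phi> z) (opB \<Phi> z) (opC \<Phi> z) = 0"
    using assms by (simp add: det_solution_def det_expr_def det_poly_def Let_def)
  ultimately have "fps_det P = 0" by (rule has_fps_expansion_eventually_zero)
  moreover have "P $ 0 = 1"
    using has_fps_expansion_imp_0_eq_fps_nth_0[OF P] assms by (simp add: det_solution_def)
  moreover have "P $ 1 = deriv \<Phi> 0"
    using has_fps_expansion_imp_0_eq_fps_nth_0[OF has_fps_expansion_deriv[OF P]] by simp
  ultimately show thesis using that P by blast
qed

lemma det_branch_has_fps_expansion:
  assumes "\<Phi> has_fps_expansion P"
  shows "det_branch \<rho> \<Phi> has_fps_expansion fps_branch \<rho> P"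
proof -
  have "(\<lambda>t. \<rho> / 16 * t ^ 4 * \<Phi> (\<rho>\<^sup>2 / 128 * t ^ 7)) has_fps_expansion fps_branch \<rho> P"
    unfolding fps_branch_def
    by (intro fps_expansion_intros has_fps_expansion_compose_monomial assms) auto
  also have "(\<lambda>t. \<rho> / 16 * t ^ 4 * \<Phi> (\<rho>\<^sup>2 / 128 * t ^ 7)) = det_branch \<rho> \<Phi>"
    by (simp add: det_branch_def fun_eq_iff power_divide)
  finally show ?thesis .
qed

lemma heat_transform_has_fps_expansion:
  fixes \<phi> :: "real \<Rightarrow> real"
  defines "\<alpha> \<equiv> \<lambda>n. (deriv ^^ n) \<phi> 0"
  assumes coeff: "\<And>k j. \<bar>heat_coeff \<alpha> k j\<bar> \<le> R ^ (k + j)" and "R > 0"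
    and f: "f has_fps_expansion F" "F $ 0 = 0"
  shows "(\<lambda>t. heat_transform \<phi> t (f t)) has_fps_expansion heat_subst F \<alpha>"
proof -
  have "(f \<longlongrightarrow> f 0) (nhds 0)"
    using has_fps_expansion_imp_continuous[OF f(1), of UNIV]
    by (simp add: continuous_within tendsto_nhds_iff)
  moreover have "f 0 = 0"
    using has_fps_expansion_imp_0_eq_fps_nth_0[OF f(1)] f(2) by simp
  ultimately have "((\<lambda>t. \<bar>f t\<bar>) \<longlongrightarrow> 0) (nhds 0)"
    using tendsto_rabs_zero by simp
  hence "\<forall>\<^sub>F t in nhds 0. \<bar>f t\<bar> < 1 / R"
    by (rule order_tendstoD) (use \<open>R > 0\<close> in simp)
  moreover have "\<forall>\<^sub>F t in nhds 0. t \<in> ball 0 (1 / R)"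
    using \<open>R > 0\<close> by (intro eventually_nhds_in_open) auto
  ultimately have ev: "\<forall>\<^sub>F t in nhds 0. heat_eval \<alpha> t (f t) = heat_transform \<phi> t (f t)"
    by eventually_elim
       (use heat_transform_eq_heat_eval(2)[of \<phi> R, folded \<alpha>_def, OF coeff \<open>R > 0\<close>] in auto)
  show ?thesis
    using heat_subst_has_fps_expansion[OF coeff \<open>R > 0\<close> f(2,1)]
    by (rule has_fps_expansion_cong[OF ev refl, THEN iffD1])
qed

lemma boundary_germ_det_branch:
  assumes \<Phi>: "\<Phi> has_fps_expansion P" "P $ 0 = 1"
    and zero: "\<forall>\<^sub>F t in nhds 0. v t (det_branch \<rho> \<Phi> t) = 0"
  shows "boundary_germ \<rho> v (det_branch \<rho> \<Phi>)"
  unfolding boundary_germ_def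
proof (intro conjI exI)
  have "(\<lambda>s. \<rho> / 16 * \<Phi> (\<rho>\<^sup>2 / 128 * s ^ 1)) has_fps_expansion
      fps_const (\<rho> / 16) * (P oo (fps_const (\<rho>\<^sup>2 / 128) * fps_X ^ 1))"
    by (intro fps_expansion_intros has_fps_expansion_compose_monomial \<Phi>) auto
  thus "analytic_germ (\<lambda>s. \<rho> / 16 * \<Phi> (\<rho>\<^sup>2 / 128 * s ^ 1))"
    unfolding analytic_germ_def by blast
  show "germ_eq (det_branch \<rho> \<Phi>) (\<lambda>t. t ^ 4 * (\<rho> / 16 * \<Phi> (\<rho>\<^sup>2 / 128 * (t ^ 7) ^ 1)))"
    by (simp add: germ_eq_def det_branch_def power_divide mult_ac)
  show "\<forall>\<^sub>F t in nhds 0. v t (det_branch \<rho> \<Phi> t) = 0" by (rule zero)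
  have "(\<lambda>t. det_branch \<rho> \<Phi> t - \<rho> / 16 * t ^ 4) has_fps_expansion
      fps_branch \<rho> P - fps_const (\<rho> / 16) * fps_X ^ 4"
    by (intro fps_expansion_intros det_branch_has_fps_expansion \<Phi>)
  moreover have "(fps_branch \<rho> P - fps_const (\<rho> / 16) * fps_X ^ 4) $ i = 0" if "i < 11" for i
    using that \<Phi>(2) dvd_imp_le[of 7 "i - 4"]
    by (auto simp: fps_branch_def mult.assoc fps_X_power_mult_nth fps_X_power_nth
          fps_compose_monomial_nth)
  ultimately show "(\<lambda>t. det_branch \<rho> \<Phi> t - \<rho> / 16 * t ^ 4) \<in> O[nhds 0](\<lambda>t. t ^ 11)"
    by (rule has_fps_expansion_bigo)
qed

lemma boundary_germ_fps:
  assumes "boundary_germ \<rho> v g"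
  obtains G where "g has_fps_expansion G" "fps_X ^ 4 dvd G"
proof -
  obtain y Y where y: "y has_fps_expansion Y" "\<forall>\<^sub>F t in nhds 0. g t = t ^ 4 * y (t ^ 7)"
    using assms by (auto simp: boundary_germ_def analytic_germ_def germ_eq_def)
  have "(\<lambda>t. t ^ 4 * y (1 * t ^ 7)) has_fps_expansion
      fps_X ^ 4 * (Y oo (fps_const 1 * fps_X ^ 7))"
    by (intro fps_expansion_intros has_fps_expansion_compose_monomial y) auto
  moreover have "g has_fps_expansion G \<longleftrightarrow> (\<lambda>t. t ^ 4 * y (1 * t ^ 7)) has_fps_expansion G" for G
    by (intro has_fps_expansion_cong refl) (use y(2) in simp)
  ultimately show thesis using that dvd_triv_left by blast
qed

lemma stationary_solution_heat_growth:
  assumes "stationary_solution \<rho> \<phi>" and "\<And>n. n < 4 \<Longrightarrow> \<bar>(deriv ^^ n) \<phi> 0\<bar> \<le> 1"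
  shows "\<bar>heat_coeff (\<lambda>n. (deriv ^^ n) \<phi> 0) k j\<bar> \<le> (16 * (1 + \<bar>\<rho>\<bar>)\<^sup>2) ^ (k + j)"
  by (intro heat_coeff_growth stationary_seq_growth stationary_solution_recurrence assms) auto

text \<open>
  The linear equation for \<open>v(t, F(t))\<close> shows that the branch is a zero curve, since the solution
  of residue \<open>r\<close> produces only exponents congruent to \<open>4 r\<close> modulo 7. It is the only one, because
  \<open>v_x(t, 0)\<close> starts with \<open>1\<close> for \<open>r = 1\<close> and with \<open>t / 2\<close> for \<open>r = 3\<close>.
\<close>

lemma det_branch_unique_boundary:
  fixes \<phi> \<Phi> :: "real \<Rightarrow> real"
  assumes "\<rho> \<noteq> 0" and stat: "stationary_solution \<rho> \<phi>"
    and r: "r \<in> {1, 3}" and init: "\<And>n. n < 4 \<Longrightarrow> (deriv ^^ n) \<phi> 0 = (if n = r then 1 else 0)"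
    and sol: "det_solution \<Phi>"
    and indicial: "\<And>n. n mod 7 = (4 * r) mod 7 \<Longrightarrow>
        n \<noteq> 0 \<and> n \<noteq> 1 \<and> deriv \<Phi> 0 * (real n - 17) + 1 \<noteq> 0"
  shows "unique_germ (boundary_germ \<rho> (heat_transform \<phi>)) (det_branch \<rho> \<Phi>)"
proof -
  define \<alpha> where "\<alpha> = (\<lambda>n. (deriv ^^ n) \<phi> 0)"
  define R where "R = 16 * (1 + \<bar>\<rho>\<bar>)\<^sup>2"
  have rec: "\<alpha> (n + 4) = - \<rho> * seq_mult_x (seq_mult_x (seq_mult_x \<alpha>)) n" for n
    unfolding \<alpha>_def by (rule stationary_solution_recurrence[OF stat])
  have coeff: "\<bar>heat_coeff \<alpha> k j\<bar> \<le> R ^ (k + j)" for k j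
    unfolding \<alpha>_def R_def by (rule stationary_solution_heat_growth[OF stat]) (simp add: init)
  have "R > 0" by (auto simp: R_def)
  note expansion = heat_transform_has_fps_expansion[of \<phi> R, folded \<alpha>_def, OF coeff \<open>R > 0\<close>]
  obtain P where P: "\<Phi> has_fps_expansion P" "P $ 0 = 1" "P $ 1 = deriv \<Phi> 0" "fps_det P = 0"
    using det_solution_fps[OF sol] by blast
  define F where "F = fps_branch \<rho> P"
  have F: "det_branch \<rho> \<Phi> has_fps_expansion F" "fps_X ^ 4 dvd F"
    using det_branch_has_fps_expansion[OF P(1)]
    by (auto simp: F_def fps_branch_def mult.assoc dvd_mult)
  have support: "\<alpha> n \<noteq> 0 \<Longrightarrow> n mod 7 = r" for n
    using stationary_seq_support[of \<alpha> \<rho> r n, OF rec] init by (auto simp: \<alpha>_def)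
  have zero: "heat_subst F \<alpha> = 0"
    unfolding F_def
  proof (rule fps_branch_heat_zero[OF \<open>\<rho> \<noteq> 0\<close> P(2,4) rec])
    fix n assume "heat_subst (fps_branch \<rho> P) \<alpha> $ n \<noteq> 0"
    hence "n mod 7 = (4 * r) mod 7"
      using heat_subst_supported[OF fps_branch_supported support]
      by (auto simp: fps_supported_def)
    thus "n \<noteq> 0 \<and> n \<noteq> 1 \<and> P $ 1 * (real n - 17) + 1 \<noteq> 0"
      using indicial P(3) by simp
  qed
  have low: "G $ 0 = 0" "fps_X ^ 2 dvd G" if "fps_X ^ 4 dvd G" for G :: "real fps"
    using that by (auto intro: fps_X_power_dvd_nth dvd_trans[OF le_imp_power_dvd[of 2 4]])
  have "boundary_germ \<rho> (heat_transform \<phi>) (det_branch \<rho> \<Phi>)"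
  proof (rule boundary_germ_det_branch[OF P(1,2)])
    show "\<forall>\<^sub>F t in nhds 0. heat_transform \<phi> t (det_branch \<rho> \<Phi> t) = 0"
      using expansion[OF F(1) low(1)[OF F(2)]] by (simp add: zero has_fps_expansion_0_iff)
  qed
  moreover have "germ_eq g (det_branch \<rho> \<Phi>)" if g: "boundary_germ \<rho> (heat_transform \<phi>) g" for g
  proof -
    obtain G where G: "g has_fps_expansion G" "fps_X ^ 4 dvd G"
      using boundary_germ_fps[OF g] .
    have "heat_subst G \<alpha> = 0"
      using expansion[OF G(1) low(1)[OF G(2)]] g
      by (auto simp: boundary_germ_def intro: has_fps_expansion_eventually_zero)
    moreover have "heat_coeff \<alpha> 0 1 \<noteq> 0 \<or> heat_coeff \<alpha> 1 1 \<noteq> 0"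
      using r init[of r] by (auto simp: heat_coeff_def \<alpha>_def numeral_3_eq_3)
    ultimately have "G = F"
      using heat_subst_inj[OF low(2)[OF G(2)] low(2)[OF F(2)], of \<alpha>] zero by simp
    thus ?thesis
      using F(1) G(1) unfolding germ_eq_def has_fps_expansion_def
      by (auto elim: eventually_elim2)
  qed
  ultimately show ?thesis unfolding unique_germ_def by blast
qed

theorem theorem10p1:
  fixes \<rho> :: real and \<phi>1 \<phi>3 \<Phi>1 \<Phi>2 :: "real \<Rightarrow> real"
  assumes "\<rho> \<noteq> 0"
    and "stationary_solution \<rho> \<phi>1"
    and "\<phi>1 0 = 0" "deriv \<phi>1 0 = 1" "(deriv ^^ 2) \<phi>1 0 = 0" "(deriv ^^ 3) \<phi>1 0 = 0"
    and "stationary_solution \<rho> \<phi>3"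
    and "\<phi>3 0 = 0" "deriv \<phi>3 0 = 0" "(deriv ^^ 2) \<phi>3 0 = 0" "(deriv ^^ 3) \<phi>3 0 = 1"
    and "det_solution \<Phi>1" "deriv \<Phi>1 0 = 1 / 5"
    and "det_solution \<Phi>2" "deriv \<Phi>2 0 = 1 / 6"
  shows "(\<forall>\<phi>\<in>{\<phi>1, \<phi>3}.
            (\<forall>\<^sub>F (t, x) in nhds (0, 0). summable (heat_term \<phi> t x)) \<and>
            analytic_near_origin (heat_transform \<phi>)) \<and>
         (\<exists>F1 F3.
            unique_germ (boundary_germ \<rho> (heat_transform \<phi>1)) F1 \<and>
            unique_germ (boundary_germ \<rho> (heat_transform \<phi>3)) F3 \<and>
            germ_eq F1 (det_branch \<rho> \<Phi>1) \<and>
            germ_eq F3 (det_branch \<rho> \<Phi>2))"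
proof -
  have less4: "n = 0 \<or> n = 1 \<or> n = 2 \<or> n = 3" if "n < 4" for n :: nat
    using that by auto
  have init1: "(deriv ^^ n) \<phi>1 0 = (if n = 1 then 1 else 0)" if "n < 4" for n
    using less4[OF that] assms(3-6) by auto
  have init3: "(deriv ^^ n) \<phi>3 0 = (if n = 3 then 1 else 0)" if "n < 4" for n
    using less4[OF that] assms(8-11) by auto
  have analytic: "(\<forall>\<^sub>F (t, x) in nhds (0, 0). summable (heat_term \<phi> t x)) \<and>
      analytic_near_origin (heat_transform \<phi>)"
    if "stationary_solution \<rho> \<phi>" "\<And>n. n < 4 \<Longrightarrow> \<bar>(deriv ^^ n) \<phi> 0\<bar> \<le> 1" for \<phi>
  proof -
    have "16 * (1 + \<bar>\<rho>\<bar>)\<^sup>2 > 0" by auto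
    thus ?thesis
      using heat_transform_analytic[of \<phi>, OF stationary_solution_heat_growth[OF that]] by blast
  qed
  have "unique_germ (boundary_germ \<rho> (heat_transform \<phi>1)) (det_branch \<rho> \<Phi>1)"
  proof (rule det_branch_unique_boundary[OF assms(1,2) _ init1 assms(12)])
    fix n :: nat assume n: "n mod 7 = (4 * 1) mod 7"
    \<comment> \<open>The exponents 0, 1, 12 are not congruent to 4 modulo 7.\<close>
    hence "n \<noteq> 0" "n \<noteq> 1" "n \<noteq> 12" by auto
    moreover have "deriv \<Phi>1 0 * (real n - 17) + 1 = (real n - 12) / 5"
      by (simp add: assms(13) field_simps)
    ultimately show "n \<noteq> 0 \<and> n \<noteq> 1 \<and> deriv \<Phi>1 0 * (real n - 17) + 1 \<noteq> 0" by simp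
  qed auto
  moreover have "unique_germ (boundary_germ \<rho> (heat_transform \<phi>3)) (det_branch \<rho> \<Phi>2)"
  proof (rule det_branch_unique_boundary[OF assms(1,7) _ init3 assms(14)])
    fix n :: nat assume n: "n mod 7 = (4 * 3) mod 7"
    \<comment> \<open>The exponents 0, 1, 11 are not congruent to 5 modulo 7.\<close>
    hence "n \<noteq> 0" "n \<noteq> 1" "n \<noteq> 11" by auto
    moreover have "deriv \<Phi>2 0 * (real n - 17) + 1 = (real n - 11) / 6"
      by (simp add: assms(15) field_simps)
    ultimately show "n \<noteq> 0 \<and> n \<noteq> 1 \<and> deriv \<Phi>2 0 * (real n - 17) + 1 \<noteq> 0" by simp
  qed auto
  moreover have "germ_eq f f" for f by (simp add: germ_eq_def)
  ultimately show ?thesis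
    using analytic[OF assms(2)] analytic[OF assms(7)] init1 init3 by auto
qed

end
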